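(* Let $\tau_{k,l,m,n}=T_{14}^n\widehat{T}_{34}^m\widehat{T}_{40}^l\widehat{T}_{13}^k(\tau_0)$ ($k,l,m,n\in\mathbb{Z}$) be the $\tau$ functions of the Painlevé VI system (type $D_4^{(1)}$) defined in the context. For $(n,m)\in\mathbb{Z}^2$ let $$z_{n,m}=\begin{cases}(-1)^{\binom{n-m+2}{2}}\,\dfrac{\tau_{-\frac{n+m}{2}+1,\,-\frac{n+m}{2}-1,\,0,\,m}}{\tau_{-\frac{n+m}{2},\,-\frac{n+m}{2},\,0,\,m}} & (n+m\text{ even}),\\[5mm](-1)^{\binom{n-m+2}{2}}\,\dfrac{\tau_{-\frac{n+m-1}{2},\,-\frac{n+m+1}{2}-1,\,-1,\,m}}{\tau_{-\frac{n+m+1}{2},\,-\frac{n+m+1}{2},\,-1,\,m}} & (n+m\text{ odd}).\end{cases}$$ Then $z_{n,m}$ satisfies the discrete Schwarzian KdV equation $$\frac{(z_{n,m}-z_{n+1,m})(z_{n+1,m+1}-z_{n,m+1})}{(z_{n+1,m}-z_{n+1,m+1})(z_{n,m+1}-z_{n,m})}=\frac1t\qquad\text{for all }(n,m)\in\mathbb{Z}^2 .$$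
   Context: For any integer $x$, $\binom{x}{2}=x(x-1)/2$. Setting. Let $\alpha_0,\dots,\alpha_4$ be parameters with $\alpha_0+\alpha_1+2\alpha_2+\alpha_3+\alpha_4=1$ (otherwise independent), $t$ a variable, $q,p$ variables, and $$f_0=q-t,\quad f_3=q-1,\quad f_4=q,\quad f_2=p .$$ Let $\tau_0,\dots,\tau_4$ be further variables. Fix branches of $t^{1/4}$ and $(t-1)^{1/4}$, with $[t(t-1)]^{1/4}=t^{1/4}(t-1)^{1/4}$, $\sqrt t=(t^{1/4})^2$, etc.; $i$ as a scalar denotes the imaginary unit and $(-1)^{x}=e^{\pi i x}$. The transformations $s_0,\dots,s_7$ are automorphisms of the field generated over $\mathbb{C}$ by $t^{1/4},(t-1)^{1/4}$, the $\alpha_j$, $q,p$, and the $\tau_j$; they fix $\mathbb{C}$, $t^{1/4}$ and $(t-1)^{1/4}$ and act as follows (in the language of Painlevé VI these are its Bäcklund transformations lifted to $\tau$ functions). For $i,j\in\{0,1,2,3,4\}$: $s_i(\alpha_j)=\alpha_j-a_{ij}\alpha_i$, where $(a_{ij})$ is the Cartan matrix of type $D_4^{(1)}$ with central node $2$: $a_{ii}=2$, $a_{2j}=a_{j2}=-1$ for $j=0,1,3,4$, and $a_{ij}=0$ otherwise; $$s_2(f_j)=f_j+\frac{\alpha_2}{f_2}\ (j=0,3,4),\quad s_2(f_2)=f_2,\qquad s_i(f_2)=f_2-\frac{\alpha_i}{f_i},\ \ s_i(f_j)=f_j\ (j=0,3,4)\quad(i=0,3,4),$$ and $s_1$ fixes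 all $f_j$; $$s_0(\tau_0)=f_0\frac{\tau_2}{\tau_0},\quad s_1(\tau_1)=\frac{\tau_2}{\tau_1},\quad s_2(\tau_2)=\frac{f_2}{\sqrt t}\frac{\tau_0\tau_1\tau_3\tau_4}{\tau_2},\quad s_3(\tau_3)=f_3\frac{\tau_2}{\tau_3},\quad s_4(\tau_4)=f_4\frac{\tau_2}{\tau_4},$$ and $s_i(\tau_j)=\tau_j$ for $i\ne j$, $0\le i,j\le 4$. $s_5$: $\alpha_0\leftrightarrow\alpha_1$, $\alpha_3\leftrightarrow\alpha_4$, $\alpha_2$ fixed, $f_2\mapsto-\dfrac{f_0(f_2f_0+\alpha_2)}{t(t-1)}$, $f_4\mapsto t\dfrac{f_3}{f_0}$; $\tau_0\mapsto[t(t-1)]^{\frac14}\tau_1$, $\tau_1\mapsto[t(t-1)]^{-\frac14}\tau_0$, $\tau_3\mapsto t^{-\frac14}(t-1)^{\frac14}\tau_4$, $\tau_4\mapsto t^{\frac14}(t-1)^{-\frac14}\tau_3$, $\tau_2\mapsto[t(t-1)]^{-\frac12}f_0\tau_2$. $s_6$: $\alpha_0\leftrightarrow\alpha_3$, $\alpha_1\leftrightarrow\alpha_4$, $\alpha_2$ fixed, $f_2\mapsto-\dfrac{f_4(f_4f_2+\alpha_2)}{t}$, $f_4\mapsto\dfrac{t}{f_4}$; $\tau_0\mapsto i\,t^{\frac14}\tau_3$, $\tau_3\mapsto-i\,t^{-\frac14}\tau_0$, $\tau_1\mapsto t^{-\frac14}\tau_4$, $\tau_4\mapsto t^{\frac14}\tau_1$,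 $\tau_2\mapsto t^{-\frac12}f_4\tau_2$. $s_7$: $\alpha_0\leftrightarrow\alpha_4$, $\alpha_1\leftrightarrow\alpha_3$, $\alpha_2$ fixed, $f_2\mapsto\dfrac{f_3(f_3f_2+\alpha_2)}{t-1}$, $f_4\mapsto\dfrac{f_0}{f_3}$; $\tau_0\mapsto(-1)^{-\frac34}(t-1)^{\frac14}\tau_4$, $\tau_4\mapsto(-1)^{\frac34}(t-1)^{-\frac14}\tau_0$, $\tau_1\mapsto(-1)^{\frac34}(t-1)^{-\frac14}\tau_3$, $\tau_3\mapsto(-1)^{-\frac34}(t-1)^{\frac14}\tau_1$, $\tau_2\mapsto-i(t-1)^{-\frac12}f_3\tau_2$. (The images of $f_0,f_3$ under $s_5,s_6,s_7$ follow from $f_0=f_4-t$, $f_3=f_4-1$.) Products are compositions of automorphisms, $(gh)(x)=g(h(x))$. The translation operators are $$\widehat T_{13}=s_1s_2s_0s_4s_2s_1s_7,\quad \widehat T_{40}=s_4s_2s_1s_3s_2s_4s_7,\quad \widehat T_{34}=s_3s_2s_0s_1s_2s_3s_5,\quad T_{14}=s_1s_4s_2s_0s_3s_2s_6,$$ which act on $\vec\alpha=(\alpha_0,\alpha_1,\alpha_2,\alpha_3,\alpha_4)$ by adding $(0,1,0,-1,0)$, $(-1,0,0,0,1)$, $(0,0,0,1,-1)$, $(0,1,-1,0,1)$, respectively. The $\tau$ functions are $\tau_{k,l,m,n}=T_{14}^n\widehat T_{34}^m\widehat T_{40}^l\widehat T_{13}^k(\tau_0)$, with operators applied in exactly this order.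 *)

theory Defs
  imports Complex_Main "HOL-Library.Poly_Mapping"
begin

section \<open>Fields over the complex numbers\<close>

definition field_embedding :: "(complex \<Rightarrow> 'a::field) \<Rightarrow> bool" where
  "field_embedding \<iota> \<longleftrightarrow>
     \<iota> 1 = 1 \<and> (\<forall>x y. \<iota> (x + y) = \<iota> x + \<iota> y) \<and> (\<forall>x y. \<iota> (x * y) = \<iota> x * \<iota> y)"

definition field_automorphism :: "('a::field \<Rightarrow> 'a) \<Rightarrow> bool" where
  "field_automorphism g \<longleftrightarrow>
     bij g \<and> (\<forall>x y. g (x + y) = g x + g y) \<and> (\<forall>x y. g (x * y) = g x * g y)"

definition is_subfield :: "'a::field set \<Rightarrow> bool" where
  "is_subfield F \<longleftrightarrow> 0 \<in> F \<and> 1 \<in> F \<and>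
     (\<forall>x\<in>F. \<forall>y\<in>F. x + y \<in> F \<and> x * y \<in> F) \<and> (\<forall>x\<in>F. - x \<in> F \<and> inverse x \<in> F)"

definition generated_field :: "'a::field set \<Rightarrow> 'a set" where
  "generated_field S = \<Inter> {F. is_subfield F \<and> S \<subseteq> F}"

text \<open>Here \<open>P\<close> is a polynomial over the complex numbers in the variables \<open>0, \<dots>, length xs - 1\<close>,
  given as a finitely supported map from monomials (exponent vectors) to coefficients; the sum is
  its value at \<open>xs\<close>.\<close>

definition alg_independent :: "(complex \<Rightarrow> 'a::field) \<Rightarrow> 'a list \<Rightarrow> bool" where
  "alg_independent \<iota> xs \<longleftrightarrow>
     (\<forall>P :: (nat \<Rightarrow>\<^sub>0 nat) \<Rightarrow>\<^sub>0 complex.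
        (\<forall>m \<in> Poly_Mapping.keys P. Poly_Mapping.keys m \<subseteq> {..<length xs}) \<longrightarrow>
        (\<Sum>m \<in> Poly_Mapping.keys P. \<iota> (Poly_Mapping.lookup P m) *
            (\<Prod>i \<in> Poly_Mapping.keys m. (xs ! i) ^ Poly_Mapping.lookup m i)) = 0 \<longrightarrow>
        P = 0)"

section \<open>The tau functions of the sixth Painleve system\<close>

definition neg_one_pow :: "real \<Rightarrow> complex" where
  "neg_one_pow x = exp (of_real (pi * x) * \<i>)"

text \<open>The Cartan matrix of type \<open>D\<^sub>4\<^sup>(\<^sup>1\<^sup>)\<close>, with central node 2.\<close>

definition cartan_D4 :: "nat \<Rightarrow> nat \<Rightarrow> int" where
  "cartan_D4 i j = (if i = j then 2 else if i = 2 \<or> j = 2 then - 1 else 0)"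

text \<open>The ambient field is the whole type \<open>'a\<close>. The elements \<open>r\<close> and \<open>u\<close> are the chosen branches
  of \<open>t\<^sup>1\<^sup>/\<^sup>4\<close> and \<open>(t - 1)\<^sup>1\<^sup>/\<^sup>4\<close>, so that \<open>r\<^sup>2\<close> is the square root of \<open>t\<close> and \<open>r * u\<close> is the
  fourth root of \<open>t * (t - 1)\<close>. Only the indices \<open>0, \<dots>, 4\<close> of \<open>\<alpha>\<close> and \<open>\<tau>\<close>, the indices
  \<open>0, 2, 3, 4\<close> of \<open>f\<close>, and the indices \<open>0, \<dots>, 7\<close> of \<open>s\<close> are meaningful. The parameter \<open>\<alpha> 0\<close> is
  missing from the list of independent elements because it is determined by the others.\<close>

locale pvi_field =
  fixes \<iota> :: "complex \<Rightarrow> 'a::field_char_0"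
    and t r u :: 'a and \<alpha> :: "nat \<Rightarrow> 'a" and q p :: 'a and f \<tau> :: "nat \<Rightarrow> 'a"
  assumes embedding: "field_embedding \<iota>"
    and quartic_roots: "r ^ 4 = t" "u ^ 4 = t - 1"
    and alpha_sum: "\<alpha> 0 + \<alpha> 1 + 2 * \<alpha> 2 + \<alpha> 3 + \<alpha> 4 = 1"
    and independent:
      "alg_independent \<iota> [t, \<alpha> 1, \<alpha> 2, \<alpha> 3, \<alpha> 4, q, p, \<tau> 0, \<tau> 1, \<tau> 2, \<tau> 3, \<tau> 4]"
    and generated:
      "generated_field (range \<iota> \<union> {r, u, q, p} \<union> \<alpha> ` {0..4} \<union> \<tau> ` {0..4}) = UNIV"
    and f_eqs: "f 0 = q - t" "f 3 = q - 1" "f 4 = q" "f 2 = p"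

locale pvi_tau_system = pvi_field \<iota> t r u \<alpha> q p f \<tau>
  for \<iota> :: "complex \<Rightarrow> 'a::field_char_0"
    and t r u :: 'a and \<alpha> :: "nat \<Rightarrow> 'a" and q p :: 'a and f \<tau> :: "nat \<Rightarrow> 'a" +
  fixes s :: "nat \<Rightarrow> 'a \<Rightarrow> 'a"
  assumes s_automorphism: "i \<le> 7 \<Longrightarrow> field_automorphism (s i)"
    and s_fixes: "i \<le> 7 \<Longrightarrow> s i (\<iota> c) = \<iota> c" "i \<le> 7 \<Longrightarrow> s i r = r" "i \<le> 7 \<Longrightarrow> s i u = u"
    and s_alpha:
      "i \<le> 4 \<Longrightarrow> j \<le> 4 \<Longrightarrow> s i (\<alpha> j) = \<alpha> j - of_int (cartan_D4 i j) * \<alpha> i"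
    and s_f:
      "j \<in> {0, 3, 4} \<Longrightarrow> s 2 (f j) = f j + \<alpha> 2 / f 2"
      "s 2 (f 2) = f 2"
      "i \<in> {0, 3, 4} \<Longrightarrow> s i (f 2) = f 2 - \<alpha> i / f i"
      "i \<in> {0, 3, 4} \<Longrightarrow> j \<in> {0, 3, 4} \<Longrightarrow> s i (f j) = f j"
      "j \<in> {0, 2, 3, 4} \<Longrightarrow> s 1 (f j) = f j"
    and s_tau:
      "s 0 (\<tau> 0) = f 0 * (\<tau> 2 / \<tau> 0)"
      "s 1 (\<tau> 1) = \<tau> 2 / \<tau> 1"
      "s 2 (\<tau> 2) = f 2 / r ^ 2 * (\<tau> 0 * \<tau> 1 * \<tau> 3 * \<tau> 4 / \<tau> 2)"
      "s 3 (\<tau> 3) = f 3 * (\<tau> 2 / \<tau> 3)"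
      "s 4 (\<tau> 4) = f 4 * (\<tau> 2 / \<tau> 4)"
      "i \<le> 4 \<Longrightarrow> j \<le> 4 \<Longrightarrow> i \<noteq> j \<Longrightarrow> s i (\<tau> j) = \<tau> j"
    and s5:
      "s 5 (\<alpha> 0) = \<alpha> 1" "s 5 (\<alpha> 1) = \<alpha> 0" "s 5 (\<alpha> 2) = \<alpha> 2" "s 5 (\<alpha> 3) = \<alpha> 4" "s 5 (\<alpha> 4) = \<alpha> 3"
      "s 5 (f 2) = - (f 0 * (f 2 * f 0 + \<alpha> 2) / (t * (t - 1)))"
      "s 5 (f 4) = t * (f 3 / f 0)"
      "s 5 (\<tau> 0) = (r * u) * \<tau> 1"
      "s 5 (\<tau> 1) = inverse (r * u) * \<tau> 0"
      "s 5 (\<tau> 3) = inverse r * u * \<tau> 4"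
      "s 5 (\<tau> 4) = r * inverse u * \<tau> 3"
      "s 5 (\<tau> 2) = inverse ((r * u) ^ 2) * f 0 * \<tau> 2"
    and s6:
      "s 6 (\<alpha> 0) = \<alpha> 3" "s 6 (\<alpha> 1) = \<alpha> 4" "s 6 (\<alpha> 2) = \<alpha> 2" "s 6 (\<alpha> 3) = \<alpha> 0" "s 6 (\<alpha> 4) = \<alpha> 1"
      "s 6 (f 2) = - (f 4 * (f 4 * f 2 + \<alpha> 2) / t)"
      "s 6 (f 4) = t / f 4"
      "s 6 (\<tau> 0) = \<iota> \<i> * r * \<tau> 3"
      "s 6 (\<tau> 3) = - \<iota> \<i> * inverse r * \<tau> 0"
      "s 6 (\<tau> 1) = inverse r * \<tau> 4"
      "s 6 (\<tau> 4) = r * \<tau> 1"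
      "s 6 (\<tau> 2) = inverse (r ^ 2) * f 4 * \<tau> 2"
    and s7:
      "s 7 (\<alpha> 0) = \<alpha> 4" "s 7 (\<alpha> 1) = \<alpha> 3" "s 7 (\<alpha> 2) = \<alpha> 2" "s 7 (\<alpha> 3) = \<alpha> 1" "s 7 (\<alpha> 4) = \<alpha> 0"
      "s 7 (f 2) = f 3 * (f 3 * f 2 + \<alpha> 2) / (t - 1)"
      "s 7 (f 4) = f 0 / f 3"
      "s 7 (\<tau> 0) = \<iota> (neg_one_pow (- 3 / 4)) * u * \<tau> 4"
      "s 7 (\<tau> 4) = \<iota> (neg_one_pow (3 / 4)) * inverse u * \<tau> 0"
      "s 7 (\<tau> 1) = \<iota> (neg_one_pow (3 / 4)) * inverse u * \<tau> 3"
      "s 7 (\<tau> 3) = \<iota> (neg_one_pow (- 3 / 4)) * u * \<tau> 1"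
      "s 7 (\<tau> 2) = - \<iota> \<i> * inverse (u ^ 2) * f 3 * \<tau> 2"

definition T13 :: "(nat \<Rightarrow> 'a \<Rightarrow> 'a) \<Rightarrow> 'a \<Rightarrow> 'a" where
  "T13 s = s 1 \<circ> s 2 \<circ> s 0 \<circ> s 4 \<circ> s 2 \<circ> s 1 \<circ> s 7"

definition T40 :: "(nat \<Rightarrow> 'a \<Rightarrow> 'a) \<Rightarrow> 'a \<Rightarrow> 'a" where
  "T40 s = s 4 \<circ> s 2 \<circ> s 1 \<circ> s 3 \<circ> s 2 \<circ> s 4 \<circ> s 7"

definition T34 :: "(nat \<Rightarrow> 'a \<Rightarrow> 'a) \<Rightarrow> 'a \<Rightarrow> 'a" where
  "T34 s = s 3 \<circ> s 2 \<circ> s 0 \<circ> s 1 \<circ> s 2 \<circ> s 3 \<circ> s 5"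

definition T14 :: "(nat \<Rightarrow> 'a \<Rightarrow> 'a) \<Rightarrow> 'a \<Rightarrow> 'a" where
  "T14 s = s 1 \<circ> s 4 \<circ> s 2 \<circ> s 0 \<circ> s 3 \<circ> s 2 \<circ> s 6"

definition int_iterate :: "('a \<Rightarrow> 'a) \<Rightarrow> int \<Rightarrow> 'a \<Rightarrow> 'a" where
  "int_iterate g k = (if 0 \<le> k then g ^^ nat k else (inv g) ^^ nat (- k))"

definition tau_fn ::
  "(nat \<Rightarrow> 'a \<Rightarrow> 'a) \<Rightarrow> (nat \<Rightarrow> 'a) \<Rightarrow> int \<Rightarrow> int \<Rightarrow> int \<Rightarrow> int \<Rightarrow> 'a" where
  "tau_fn s \<tau> k l m n =
     int_iterate (T14 s) n (int_iterate (T34 s) m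
       (int_iterate (T40 s) l (int_iterate (T13 s) k (\<tau> 0))))"

section \<open>The solution of the discrete Schwarzian KdV equation\<close>

text \<open>The divisions by 2 below are all exact, and \<open>x * (x - 1) div 2\<close> is never negative.\<close>

definition int_binom2 :: "int \<Rightarrow> nat" where
  "int_binom2 x = nat (x * (x - 1) div 2)"

definition dskdv_z ::
  "(nat \<Rightarrow> 'a::field \<Rightarrow> 'a) \<Rightarrow> (nat \<Rightarrow> 'a) \<Rightarrow> int \<Rightarrow> int \<Rightarrow> 'a" where
  "dskdv_z s \<tau> n m =
     (if even (n + m) then
        (- 1) ^ int_binom2 (n - m + 2) *
        (tau_fn s \<tau> (- ((n + m) div 2) + 1) (- ((n + m) div 2) - 1) 0 m /
         tau_fn s \<tau> (- ((n + m) div 2)) (- ((n + m) div 2)) 0 m)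
      else
        (- 1) ^ int_binom2 (n - m + 2) *
        (tau_fn s \<tau> (- ((n + m - 1) div 2)) (- ((n + m + 1) div 2) - 1) (- 1) m /
         tau_fn s \<tau> (- ((n + m + 1) div 2)) (- ((n + m + 1) div 2)) (- 1) m))"

end

(* The maps s_0, ..., s_4 satisfy the Coxeter relations of affine D4, and s_5, s_6, s_7 permute them
   up to sign changes of the tau variables. Hence two of the translations commute up to a commutator
   that scales each tau_j by l and tau_2 by l^2 with l^4 = 1; such a scaling commutes with all s_k, so
   it fixes every quotient of two elements of the orbit of tau_0, and on these the translations
   commute. This makes each elementary square of z the image, under an automorphism fixing t, of one of
   two squares. In both, the four values are the images under one Weyl group element of the ratios
   y_j = h(tau_j) / tau_j, j = 0, 1, 3, 4, where h is the translation along the root alpha_2.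
   Explicitly y_j = K (F + (1 - alpha_2) / f_j), where y_1 = K F corresponds to f_1 = infinity, so the
   cross ratio of the y_j is that of q - t, infinity, q, q - 1, which is 1 / t. *)

theory Submission
  imports Defs
begin

text \<open>Only short relations are checked on the generators as identities of rational functions;
  products of translations are compared as words in normal form. The tau variables obstruct a plain
  group argument: s_5, s_6, s_7 commute with s_2 only up to the sign of tau_2. Sign changes are
  therefore treated as automorphisms that pass through every s_k. The binomial sign in z answers the
  failure of commutativity: on the orbit of tau_0, moving T40^-1 through T13^-k costs (-1)^k, and
  after cancellation a sign depending on m alone remains. The ratios y_j enter because T40^-1 T13
  shifts alpha by (1, 1, 0, -1, -1), which is the shift of h conjugated by s_3 s_4. The other
  translations carry tau_0 to constants times Weyl images of tau_1, tau_3, tau_4, so every vertex of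
  a square compares such an image with its translate under one and the same conjugate of h.\<close>

declare One_nat_def [simp del]

section \<open>Field automorphisms and algebraic independence\<close>

lemma automorphism_bij: "field_automorphism g \<Longrightarrow> bij g"
  by (simp add: field_automorphism_def)

lemma automorphism_add: "field_automorphism g \<Longrightarrow> g (x + y) = g x + g y"
  by (simp add: field_automorphism_def)

lemma automorphism_mult: "field_automorphism g \<Longrightarrow> g (x * y) = g x * g y"
  by (simp add: field_automorphism_def)

lemma automorphism_0: "field_automorphism g \<Longrightarrow> g 0 = 0"
  using automorphism_add[of g 0 0] by (metis add_cancel_right_right)

lemma automorphism_eq_0_iff: "field_automorphism g \<Longrightarrow> g x = 0 \<longleftrightarrow> x = 0"
  using automorphism_0[of g] automorphism_bij[of g] by (metis bij_pointE)

lemma automorphism_1: "field_automorphism g \<Longrightarrow> g 1 = 1"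
  using automorphism_mult[of g 1 1] automorphism_eq_0_iff[of g 1] by simp

lemma automorphism_uminus: "field_automorphism g \<Longrightarrow> g (- x) = - g x"
  using automorphism_add[of g x "- x"] automorphism_0[of g] by (simp add: eq_neg_iff_add_eq_0 add.commute)

lemma automorphism_diff: "field_automorphism g \<Longrightarrow> g (x - y) = g x - g y"
  using automorphism_add[of g x "- y"] automorphism_uminus[of g y] by simp

lemma automorphism_inverse: "field_automorphism g \<Longrightarrow> g (inverse x) = inverse (g x)"
proof (cases "x = 0")
  case False
  assume g: "field_automorphism g"
  have "g x * g (inverse x) = 1"
    using automorphism_mult[OF g, of x "inverse x"] automorphism_1[OF g] False by simp
  then show ?thesis by (metis inverse_unique)
qed (simp add: automorphism_0)

lemma automorphism_divide: "field_automorphism g \<Longrightarrow> g (x / y) = g x / g y"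
  by (simp add: divide_inverse automorphism_mult automorphism_inverse)

lemma automorphism_power: "field_automorphism g \<Longrightarrow> g (x ^ n) = g x ^ n"
  by (induction n) (simp_all add: automorphism_1 automorphism_mult)

lemmas automorphism_simps = automorphism_add automorphism_mult automorphism_0 automorphism_1
  automorphism_uminus automorphism_diff automorphism_inverse automorphism_divide automorphism_power

lemma automorphism_comp:
  "field_automorphism g \<Longrightarrow> field_automorphism h \<Longrightarrow> field_automorphism (g \<circ> h)"
  by (simp add: field_automorphism_def bij_comp)

lemma automorphism_inv:
  assumes g: "field_automorphism g"
  shows "field_automorphism (inv g)"
proof -
  have b: "bij g" using automorphism_bij[OF g] .
  have *: "g (inv g x) = x" for x using b by (simp add: bij_is_surj surj_f_inv_f)
  have "inv g (x + y) = inv g x + inv g y" "inv g (x * y) = inv g x * inv g y" for x y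
    by (metis * g automorphism_add b bij_inv_eq_iff, metis * g automorphism_mult b bij_inv_eq_iff)
  then show ?thesis by (simp add: field_automorphism_def b bij_imp_bij_inv)
qed

text \<open>The elements on which two automorphisms agree form a subfield.\<close>

lemma automorphism_eqI:
  assumes gen: "generated_field S = UNIV"
    and g: "field_automorphism g" and h: "field_automorphism h"
    and eq: "\<And>x. x \<in> S \<Longrightarrow> g x = h x"
  shows "g x = h x"
proof -
  have "is_subfield {x. g x = h x}"
    using g h by (simp add: is_subfield_def automorphism_simps)
  then have "generated_field S \<subseteq> {x. g x = h x}"
    using eq by (auto simp: generated_field_def)
  then show ?thesis using gen by auto
qed

text \<open>Relations of degree one are enough to separate the generators from 0, from 1 and from
  each other; further denominators are reached from these through automorphisms and
  products.\<close>

lemma alg_independent_linear: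
  assumes ind: "alg_independent \<iota> xs" and emb: "field_embedding \<iota>"
    and ij: "i < length xs" "j < length xs" "i \<noteq> j"
    and eq: "\<iota> a + \<iota> b * xs ! i + \<iota> c * xs ! j = 0"
  shows "a = 0 \<and> b = 0 \<and> c = 0"
proof -
  let ?mi = "Poly_Mapping.single i (1::nat)" and ?mj = "Poly_Mapping.single j (1::nat)"
  define P where "P = Poly_Mapping.single 0 a + Poly_Mapping.single ?mi b + Poly_Mapping.single ?mj c"
  have ne: "?mi \<noteq> 0" "?mj \<noteq> 0" "?mi \<noteq> ?mj"
    using ij by (auto simp: poly_mapping_eq_iff fun_eq_iff lookup_single when_def) 
  have lk: "Poly_Mapping.lookup P 0 = a" "Poly_Mapping.lookup P ?mi = b" "Poly_Mapping.lookup P ?mj = c"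
    unfolding P_def using ne by (simp_all add: Poly_Mapping.lookup_add lookup_single when_def)
  have keys: "Poly_Mapping.keys P \<subseteq> {0, ?mi, ?mj}"
    using ne by (auto simp: P_def in_keys_iff Poly_Mapping.lookup_add lookup_single when_def split: if_splits)
  have i0: "\<iota> 0 = 0" using emb unfolding field_embedding_def by (metis add_cancel_right_right)
  let ?term = "\<lambda>m. \<iota> (Poly_Mapping.lookup P m) * (\<Prod>i \<in> Poly_Mapping.keys m. (xs ! i) ^ Poly_Mapping.lookup m i)"
  have "(\<Sum>m \<in> Poly_Mapping.keys P. ?term m) = (\<Sum>m \<in> {0, ?mi, ?mj}. ?term m)"
    by (rule sum.mono_neutral_left) (use keys in \<open>auto simp: in_keys_iff i0\<close>)
  also have "\<dots> = 0"
    using ne lk eq by (simp add: add.assoc)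
  finally have "P = 0"
    using ind keys ij unfolding alg_independent_def by (auto dest!: spec[of _ P] split: if_splits)
  then show ?thesis using lk by auto
qed

section \<open>Nonvanishing of the generators and the scalars i and e^(3 pi i / 4)\<close>

context pvi_field
begin

lemma embedding_add: "\<iota> (x + y) = \<iota> x + \<iota> y"
  and embedding_mult: "\<iota> (x * y) = \<iota> x * \<iota> y"
  and embedding_1: "\<iota> 1 = 1"
  using embedding by (auto simp: field_embedding_def)

lemma embedding_0: "\<iota> 0 = 0"
  using embedding_add[of 0 0] by (metis add_cancel_right_right)

lemma embedding_neg_1: "\<iota> (- 1) = - 1"
  using embedding_add[of "- 1" 1] by (simp add: embedding_0 embedding_1 eq_neg_iff_add_eq_0)

lemma generators_neq:
  assumes "i < 12" "j < 12" "i \<noteq> j"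
  defines "g \<equiv> (!) [t, \<alpha> 1, \<alpha> 2, \<alpha> 3, \<alpha> 4, q, p, \<tau> 0, \<tau> 1, \<tau> 2, \<tau> 3, \<tau> 4]"
  shows "g i \<noteq> 0" "g i \<noteq> 1" "g i \<noteq> g j"
proof -
  note lin = alg_independent_linear[OF independent embedding, of i j]
  show "g i \<noteq> 0" using lin[of 0 1 0] assms(1-3) by (auto simp: g_def embedding_0 embedding_1)
  show "g i \<noteq> 1" using lin[of "- 1" 1 0] assms(1-3)
    by (auto simp: g_def embedding_0 embedding_1 embedding_neg_1)
  show "g i \<noteq> g j" using lin[of 0 1 "- 1"] assms(1-3)
    by (auto simp: g_def embedding_0 embedding_1 embedding_neg_1)
qed

lemma nonzero:
  "t \<noteq> 0" "t \<noteq> 1" "q \<noteq> 0" "q \<noteq> 1" "q \<noteq> t" "t \<noteq> q" "p \<noteq> 0"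
  "\<tau> 0 \<noteq> 0" "\<tau> 1 \<noteq> 0" "\<tau> 2 \<noteq> 0" "\<tau> 3 \<noteq> 0" "\<tau> 4 \<noteq> 0"
  using generators_neq[of 0 5] generators_neq[of 5 0] generators_neq[of 6 0] generators_neq[of 7 0]
    generators_neq[of 8 0] generators_neq[of 9 0] generators_neq[of 10 0] generators_neq[of 11 0]
  by (simp_all add: numeral_nat One_nat_def)

lemma roots_nonzero: "r \<noteq> 0" "u \<noteq> 0"
  using quartic_roots nonzero by auto

lemma r_power4: "r * (r * (r * r)) = t" and u_power4: "u * (u * (u * u)) = t - 1"
  using quartic_roots by (simp_all add: power4_eq_xxxx mult.assoc)

definition J :: 'a where "J = \<iota> \<i>"
definition Z :: 'a where "Z = \<iota> (neg_one_pow (3 / 4))"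

lemma J_square: "J * J = - 1"
  by (simp add: J_def embedding_neg_1 flip: embedding_mult)

lemma Z_square: "Z * Z = - J"
proof -
  have "neg_one_pow (3 / 4) * neg_one_pow (3 / 4) = exp (of_real (3 / 2 * pi) * \<i>)"
    by (simp add: neg_one_pow_def flip: exp_add) (simp add: field_simps)
  also have "\<dots> = cis (3 / 2 * pi)"
    by (simp add: cis_conv_exp mult.commute)
  also have "\<dots> = - 1 * \<i>"
    by (simp only: complex_eq_iff cis.simps cos_3over2_pi sin_3over2_pi) simp
  finally show ?thesis
    unfolding Z_def J_def by (metis embedding_mult embedding_neg_1 mult_minus1)
qed

lemma J_nonzero: "J \<noteq> 0" and Z_nonzero: "Z \<noteq> 0"
  using J_square Z_square by auto

lemma Z_inverse: "\<iota> (neg_one_pow (- 3 / 4)) = inverse Z"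
proof -
  have "neg_one_pow (3 / 4) * neg_one_pow (- 3 / 4) = 1"
    by (simp add: neg_one_pow_def flip: exp_add)
  then have "Z * \<iota> (neg_one_pow (- 3 / 4)) = 1"
    by (metis Z_def embedding_1 embedding_mult)
  then show ?thesis by (metis inverse_unique)
qed

end

section \<open>Values on the generators and nonvanishing denominators\<close>

context pvi_tau_system
begin

lemma s_iota_const: "k \<le> 7 \<Longrightarrow> s k J = J" "k \<le> 7 \<Longrightarrow> s k Z = Z"
  by (simp_all add: J_def Z_def s_fixes)

lemmas s_hom = automorphism_simps[OF s_automorphism]

lemma s_t: "k \<le> 7 \<Longrightarrow> s k t = t"
  using s_hom(9)[of k r 4] by (simp add: quartic_roots s_fixes)

lemmas s_const = s_iota_const s_t s_fixes

lemma s_eq_0_iff: "k \<le> 7 \<Longrightarrow> s k x = 0 \<longleftrightarrow> x = 0"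
  by (rule automorphism_eq_0_iff[OF s_automorphism])

lemma s_alpha_values:
  "s 0 (\<alpha> 0) = - \<alpha> 0" "s 0 (\<alpha> 1) = \<alpha> 1"
  "s 0 (\<alpha> 2) = \<alpha> 2 + \<alpha> 0" "s 0 (\<alpha> 3) = \<alpha> 3" "s 0 (\<alpha> 4) = \<alpha> 4"
  "s 1 (\<alpha> 0) = \<alpha> 0" "s 1 (\<alpha> 1) = - \<alpha> 1"
  "s 1 (\<alpha> 2) = \<alpha> 2 + \<alpha> 1" "s 1 (\<alpha> 3) = \<alpha> 3" "s 1 (\<alpha> 4) = \<alpha> 4"
  "s 2 (\<alpha> 0) = \<alpha> 0 + \<alpha> 2" "s 2 (\<alpha> 1) = \<alpha> 1 + \<alpha> 2"
  "s 2 (\<alpha> 2) = - \<alpha> 2" "s 2 (\<alpha> 3) = \<alpha> 3 + \<alpha> 2"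
  "s 2 (\<alpha> 4) = \<alpha> 4 + \<alpha> 2"
  "s 3 (\<alpha> 0) = \<alpha> 0" "s 3 (\<alpha> 1) = \<alpha> 1" "s 3 (\<alpha> 2) = \<alpha> 2 + \<alpha> 3"
  "s 3 (\<alpha> 3) = - \<alpha> 3" "s 3 (\<alpha> 4) = \<alpha> 4"
  "s 4 (\<alpha> 0) = \<alpha> 0" "s 4 (\<alpha> 1) = \<alpha> 1" "s 4 (\<alpha> 2) = \<alpha> 2 + \<alpha> 4"
  "s 4 (\<alpha> 3) = \<alpha> 3" "s 4 (\<alpha> 4) = - \<alpha> 4"
  by (simp_all add: s_alpha cartan_D4_def)

lemma s_q_values:
  "s 0 q = q" "s 1 q = q" "s 2 q = q + \<alpha> 2 / p" "s 3 q = q" "s 4 q = q"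
  "s 5 q = t * (q - 1) / (q - t)" "s 6 q = t / q" "s 7 q = (q - t) / (q - 1)"
  using s_f(1)[of 4] s_f(4)[of 0 4] s_f(4)[of 3 4] s_f(4)[of 4 4] s_f(5)[of 4] s5(7) s6(7) s7(7)
  by (simp_all add: f_eqs)

lemma s_p_values:
  "s 0 p = p - \<alpha> 0 / (q - t)" "s 1 p = p" "s 2 p = p" "s 3 p = p - \<alpha> 3 / (q - 1)"
  "s 4 p = p - \<alpha> 4 / q"
  "s 5 p = - ((q - t) * (p * (q - t) + \<alpha> 2)) / (t * (t - 1))"
  "s 6 p = - (q * (q * p + \<alpha> 2)) / t"
  "s 7 p = (q - 1) * ((q - 1) * p + \<alpha> 2) / (t - 1)"
  using s_f(2) s_f(3)[of 0] s_f(3)[of 3] s_f(3)[of 4] s_f(5)[of 2] s5(6) s6(6) s7(6)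
  by (simp_all add: f_eqs)

lemma s_tau_fixed:
  "s 0 (\<tau> 1) = \<tau> 1" "s 0 (\<tau> 2) = \<tau> 2" "s 0 (\<tau> 3) = \<tau> 3" "s 0 (\<tau> 4) = \<tau> 4"
  "s 1 (\<tau> 0) = \<tau> 0" "s 1 (\<tau> 2) = \<tau> 2" "s 1 (\<tau> 3) = \<tau> 3" "s 1 (\<tau> 4) = \<tau> 4"
  "s 2 (\<tau> 0) = \<tau> 0" "s 2 (\<tau> 1) = \<tau> 1" "s 2 (\<tau> 3) = \<tau> 3" "s 2 (\<tau> 4) = \<tau> 4"
  "s 3 (\<tau> 0) = \<tau> 0" "s 3 (\<tau> 1) = \<tau> 1" "s 3 (\<tau> 2) = \<tau> 2" "s 3 (\<tau> 4) = \<tau> 4"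
  "s 4 (\<tau> 0) = \<tau> 0" "s 4 (\<tau> 1) = \<tau> 1" "s 4 (\<tau> 2) = \<tau> 2" "s 4 (\<tau> 3) = \<tau> 3"
  by (simp_all add: s_tau(6))

lemma s_tau_moved:
  "s 0 (\<tau> 0) = (q - t) * \<tau> 2 / \<tau> 0" "s 1 (\<tau> 1) = \<tau> 2 / \<tau> 1"
  "s 2 (\<tau> 2) = p * \<tau> 0 * \<tau> 1 * \<tau> 3 * \<tau> 4 / (r * r * \<tau> 2)"
  "s 3 (\<tau> 3) = (q - 1) * \<tau> 2 / \<tau> 3" "s 4 (\<tau> 4) = q * \<tau> 2 / \<tau> 4"
  by (simp_all add: s_tau f_eqs power2_eq_square mult.assoc)

lemma s_tau_diagram:
  "s 5 (\<tau> 0) = r * u * \<tau> 1" "s 5 (\<tau> 1) = inverse r * inverse u * \<tau> 0"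
  "s 5 (\<tau> 3) = inverse r * u * \<tau> 4" "s 5 (\<tau> 4) = r * inverse u * \<tau> 3"
  "s 6 (\<tau> 0) = J * r * \<tau> 3" "s 6 (\<tau> 3) = - J * inverse r * \<tau> 0"
  "s 6 (\<tau> 1) = inverse r * \<tau> 4" "s 6 (\<tau> 4) = r * \<tau> 1"
  "s 7 (\<tau> 0) = inverse Z * u * \<tau> 4" "s 7 (\<tau> 4) = Z * inverse u * \<tau> 0"
  "s 7 (\<tau> 1) = Z * inverse u * \<tau> 3" "s 7 (\<tau> 3) = inverse Z * u * \<tau> 1"
  using s5 s6 s7 Z_inverse by (simp_all add: J_def Z_def)

lemma s_tau_2:
  "s 5 (\<tau> 2) = (q - t) * \<tau> 2 / (r * r * u * u)" "s 6 (\<tau> 2) = q * \<tau> 2 / (r * r)"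
  "s 7 (\<tau> 2) = - J * (q - 1) * \<tau> 2 / (u * u)"
  using s5(12) s6(12) s7(12)
  by (simp_all add: f_eqs J_def power2_eq_square divide_inverse mult_ac)

lemmas s_values = s_alpha_values s_q_values s_p_values s_tau_fixed s_tau_moved s_tau_diagram s_tau_2
  s5(1-5) s6(1-5) s7(1-5)

text \<open>Automorphisms preserve being nonzero: up to nonzero factors, the expressions are the
  images of \<open>p\<close> under s_0, s_3, s_4 and of \<open>q - t\<close>, \<open>q - 1\<close>,
  \<open>q\<close> under s_2.\<close>

lemma nonzero_images:
  "p * (q - t) - \<alpha> 0 \<noteq> 0" "p * (q - 1) - \<alpha> 3 \<noteq> 0" "p * q - \<alpha> 4 \<noteq> 0"
  "p * (q - t) + \<alpha> 2 \<noteq> 0" "p * (q - 1) + \<alpha> 2 \<noteq> 0" "p * q + \<alpha> 2 \<noteq> 0"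
proof -
  note nz = nonzero roots_nonzero
  have "s 0 p \<noteq> 0" "s 3 p \<noteq> 0" "s 4 p \<noteq> 0" "s 2 (q - t) \<noteq> 0"
    "s 2 (q - 1) \<noteq> 0" "s 2 q \<noteq> 0"
    using nz by (simp_all add: s_eq_0_iff)
  then show "p * (q - t) - \<alpha> 0 \<noteq> 0" "p * (q - 1) - \<alpha> 3 \<noteq> 0"
    "p * q - \<alpha> 4 \<noteq> 0"
    "p * (q - t) + \<alpha> 2 \<noteq> 0" "p * (q - 1) + \<alpha> 2 \<noteq> 0" "p * q + \<alpha> 2 \<noteq> 0"
    using nz by (auto simp: s_values s_hom s_const field_simps)
qed

text \<open>If \<open>\<alpha> 2\<close> were 1, then s_2 would fix it, but s_2 negates it. The
  element is a common factor of the differences of the ratios y_j, whose cross ratio would otherwise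
  be 0 / 0.\<close>

lemma nonzero_sum: "1 - \<alpha> 2 \<noteq> 0"
proof
  assume "1 - \<alpha> 2 = 0"
  then have "\<alpha> 2 = 1" by simp
  moreover from this have "s 2 (\<alpha> 2) = 1" by (simp add: s_hom)
  ultimately have "(- 1 :: 'a) = 1" using s_alpha_values(13) by metis
  then show False by simp
qed

lemma word_eqI:
  assumes g: "field_automorphism g" and h: "field_automorphism h"
    and "\<And>c. g (\<iota> c) = h (\<iota> c)" "g r = h r" "g u = h u" "g q = h q" "g p = h p"
    and "\<And>j. j \<in> {0, 1, 2, 3, 4} \<Longrightarrow> g (\<alpha> j) = h (\<alpha> j)"
    and "\<And>j. j \<in> {0, 1, 2, 3, 4} \<Longrightarrow> g (\<tau> j) = h (\<tau> j)"
  shows "g x = h x"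
proof (rule automorphism_eqI[OF generated g h])
  have "{0..4} = {0, 1, 2, 3, 4 :: nat}" by auto
  then show "g y = h y" if "y \<in> range \<iota> \<union> {r, u, q, p} \<union> \<alpha> ` {0..4} \<union> \<tau> ` {0..4}" for y
    using that assms(3-) by auto
qed

section \<open>Relations between the transformations\<close>

text \<open>The last letter acts first, so concatenation is composition, and reversal is inversion
  because all letters are involutions.\<close>

definition act :: "nat list \<Rightarrow> 'a \<Rightarrow> 'a" where
  "act ws = foldr s ws"

lemma act_simps: "act [] x = x" "act (k # ws) x = s k (act ws x)"
  by (simp_all add: act_def)

lemma automorphism_act: "set ws \<subseteq> {..7} \<Longrightarrow> field_automorphism (act ws)"
proof (induction ws)
  case Nil
  then show ?case by (simp add: field_automorphism_def act_def bij_def inj_def)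
next
  case (Cons k ws)
  then have "field_automorphism (s k \<circ> act ws)"
    by (intro automorphism_comp s_automorphism) auto
  then show ?case by (simp add: act_def comp_def)
qed

lemma act_const:
  "set ws \<subseteq> {..7} \<Longrightarrow> act ws (\<iota> c) = \<iota> c \<and> act ws r = r \<and> act ws u = u"
  by (induction ws) (auto simp: act_simps s_const)

lemma act_eqI:
  assumes "set vs \<subseteq> {..7}" "set ws \<subseteq> {..7}"
    and "act vs q = act ws q" "act vs p = act ws p"
    and "act vs (\<alpha> 0) = act ws (\<alpha> 0)" "act vs (\<alpha> 1) = act ws (\<alpha> 1)"
      "act vs (\<alpha> 2) = act ws (\<alpha> 2)" "act vs (\<alpha> 3) = act ws (\<alpha> 3)"
      "act vs (\<alpha> 4) = act ws (\<alpha> 4)"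
    and "act vs (\<tau> 0) = act ws (\<tau> 0)" "act vs (\<tau> 1) = act ws (\<tau> 1)"
      "act vs (\<tau> 2) = act ws (\<tau> 2)" "act vs (\<tau> 3) = act ws (\<tau> 3)"
      "act vs (\<tau> 4) = act ws (\<tau> 4)"
  shows "act vs x = act ws x"
  by (rule word_eqI[OF automorphism_act automorphism_act])
     (use assms act_const[OF assms(1)] act_const[OF assms(2)] in auto)

lemmas act_eval = act_simps s_hom s_const s_values

text \<open>The trailing factor \<open>x\<close>, here and in \<open>root_powers\<close>, lets the
  rules fire inside products that \<open>algebra_simps\<close> has associated to the right.\<close>

lemma JZ_square:
  "J * (J * x) = - x" "Z * (Z * x) = - (J * x)"
  using J_square Z_square by (simp_all flip: mult.assoc)

lemma root_powers:
  "r * (r * (r * (r * x))) = t * x" "u * (u * (u * (u * x))) = (t - 1) * x"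
  using r_power4 u_power4 by (simp_all flip: mult.assoc)

text \<open>Shapes that denominators take once fractions are cleared. The long ones factor: the
  difference of the two sides is, for instance,
  \<open>(q - t) * (p * (q - t) + \<alpha> 2)\<close>.\<close>

lemma nonzero_compound:
  "p * (q - t) \<noteq> \<alpha> 0" "p * (q - 1) \<noteq> \<alpha> 3" "p * q \<noteq> \<alpha> 4"
  "q * p - t * p \<noteq> \<alpha> 0" "q * p - p \<noteq> \<alpha> 3" "q * p \<noteq> \<alpha> 4"
  "q * p + \<alpha> 2 \<noteq> t * p" "q * p + \<alpha> 2 \<noteq> p" "q * p + \<alpha> 2 \<noteq> 0"
  "(q - 1) * p + \<alpha> 2 \<noteq> 0"
  "q * (p * (q - t) - \<alpha> 0) + (\<alpha> 2 + \<alpha> 0) * (q - t) \<noteq> t * (p * (q - t) - \<alpha> 0)"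
  "q * (p * (q - 1) - \<alpha> 3) + (\<alpha> 2 + \<alpha> 3) * (q - 1) \<noteq> p * (q - 1) - \<alpha> 3"
  "q * (p * q - \<alpha> 4) + (\<alpha> 2 + \<alpha> 4) * q \<noteq> 0"
  "t * (q - 1) \<noteq> q - t" "q - t \<noteq> t * (q - 1)"
proof -
  have neqI: "a \<noteq> b" if "a - b = c" "c \<noteq> 0" for a b c :: 'a
    using that by auto
  show "q * (p * (q - t) - \<alpha> 0) + (\<alpha> 2 + \<alpha> 0) * (q - t) \<noteq> t * (p * (q - t) - \<alpha> 0)"
    by (rule neqI[of _ _ "(q - t) * (p * (q - t) + \<alpha> 2)"])
      (simp add: algebra_simps, use nonzero nonzero_images in simp)
  show "q * (p * (q - 1) - \<alpha> 3) + (\<alpha> 2 + \<alpha> 3) * (q - 1) \<noteq> p * (q - 1) - \<alpha> 3"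
    by (rule neqI[of _ _ "(q - 1) * (p * (q - 1) + \<alpha> 2)"])
      (simp add: algebra_simps, use nonzero nonzero_images in simp)
  show "q * (p * q - \<alpha> 4) + (\<alpha> 2 + \<alpha> 4) * q \<noteq> 0"
    by (rule neqI[of _ _ "q * (p * q + \<alpha> 2)"])
      (simp add: algebra_simps, use nonzero nonzero_images in simp)
  show "t * (q - 1) \<noteq> q - t"
    by (rule neqI[of _ _ "q * (t - 1)"]) (use nonzero in \<open>simp_all add: algebra_simps\<close>)
  then show "q - t \<noteq> t * (q - 1)" by metis
qed (use nonzero_images in \<open>simp_all add: algebra_simps\<close>)

lemmas root_identities = r_power4 u_power4 root_powers JZ_square J_square Z_square

lemmas nz = nonzero roots_nonzero J_nonzero Z_nonzero nonzero_images nonzero_compound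

lemma involution_words:
  "act [0, 0] x = act [] x"
  "act [1, 1] x = act [] x"
  "act [2, 2] x = act [] x"
  "act [3, 3] x = act [] x"
  "act [4, 4] x = act [] x"
  "act [5, 5] x = act [] x"
  "act [6, 6] x = act [] x"
  "act [7, 7] x = act [] x"
  by (rule act_eqI; (simp add: act_eval nz; fail)?; (simp add: act_eval nz algebra_simps; fail)?;
      (simp add: act_eval nz)?; (simp add: divide_simps nz)?;
      (simp add: algebra_simps root_identities; fail)?)+

lemma s_involution:
  "s 0 (s 0 x) = x"
  "s 1 (s 1 x) = x"
  "s 2 (s 2 x) = x"
  "s 3 (s 3 x) = x"
  "s 4 (s 4 x) = x"
  "s 5 (s 5 x) = x"
  "s 6 (s 6 x) = x"
  "s 7 (s 7 x) = x"
  using involution_words[of x] by (simp_all add: act_simps)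

lemma commute_words:
  "act [1, 0] x = act [0, 1] x"
  "act [3, 0] x = act [0, 3] x"
  "act [4, 0] x = act [0, 4] x"
  "act [3, 1] x = act [1, 3] x"
  "act [4, 1] x = act [1, 4] x"
  "act [4, 3] x = act [3, 4] x"
  by (rule act_eqI; (simp add: act_eval nz; fail)?; (simp add: act_eval nz algebra_simps; fail)?;
      (simp add: act_eval nz)?; (simp add: divide_simps nz)?;
      (simp add: algebra_simps root_identities; fail)?)+

lemma s_commute:
  "s 1 (s 0 x) = s 0 (s 1 x)"
  "s 3 (s 0 x) = s 0 (s 3 x)"
  "s 4 (s 0 x) = s 0 (s 4 x)"
  "s 3 (s 1 x) = s 1 (s 3 x)"
  "s 4 (s 1 x) = s 1 (s 4 x)"
  "s 4 (s 3 x) = s 3 (s 4 x)"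
  using commute_words[of x] by (simp_all add: act_simps)

lemma braid_words:
  "act [0, 2, 0] x = act [2, 0, 2] x"
  "act [1, 2, 1] x = act [2, 1, 2] x"
  "act [3, 2, 3] x = act [2, 3, 2] x"
  "act [4, 2, 4] x = act [2, 4, 2] x"
  by (rule act_eqI; (simp add: act_eval nz; fail)?; (simp add: act_eval nz algebra_simps; fail)?;
      (simp add: act_eval nz)?; (simp add: divide_simps nz)?;
      (simp add: algebra_simps root_identities; fail)?)+

lemma s_braid:
  "s 0 (s 2 (s 0 x)) = s 2 (s 0 (s 2 x))"
  "s 1 (s 2 (s 1 x)) = s 2 (s 1 (s 2 x))"
  "s 3 (s 2 (s 3 x)) = s 2 (s 3 (s 2 x))"
  "s 4 (s 2 (s 4 x)) = s 2 (s 4 (s 2 x))"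
  using braid_words[of x] by (simp_all add: act_simps)

text \<open>s_5, s_6, s_7 realise the diagram symmetries (01)(34), (03)(14), (04)(13). The central
  letter 2 is treated separately in \<open>s_2_diagram\<close>, since there a sign on tau_2
  appears.\<close>

lemma diagram_words:
  "act [5, 0] x = act [1, 5] x"
  "act [5, 1] x = act [0, 5] x"
  "act [5, 3] x = act [4, 5] x"
  "act [5, 4] x = act [3, 5] x"
  "act [6, 0] x = act [3, 6] x"
  "act [6, 1] x = act [4, 6] x"
  "act [6, 3] x = act [0, 6] x"
  "act [6, 4] x = act [1, 6] x"
  "act [7, 0] x = act [4, 7] x"
  "act [7, 1] x = act [3, 7] x"
  "act [7, 3] x = act [1, 7] x"
  "act [7, 4] x = act [0, 7] x"
  by (rule act_eqI; (simp add: act_eval nz; fail)?; (simp add: act_eval nz algebra_simps; fail)?;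
      (simp add: act_eval nz)?; (simp add: divide_simps nz)?;
      (simp add: algebra_simps root_identities; fail)?)+

lemma s_diagram:
  "s 5 (s 0 x) = s 1 (s 5 x)"
  "s 5 (s 1 x) = s 0 (s 5 x)"
  "s 5 (s 3 x) = s 4 (s 5 x)"
  "s 5 (s 4 x) = s 3 (s 5 x)"
  "s 6 (s 0 x) = s 3 (s 6 x)"
  "s 6 (s 1 x) = s 4 (s 6 x)"
  "s 6 (s 3 x) = s 0 (s 6 x)"
  "s 6 (s 4 x) = s 1 (s 6 x)"
  "s 7 (s 0 x) = s 4 (s 7 x)"
  "s 7 (s 1 x) = s 3 (s 7 x)"
  "s 7 (s 3 x) = s 1 (s 7 x)"
  "s 7 (s 4 x) = s 0 (s 7 x)"
  using diagram_words[of x] by (simp_all add: act_simps)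

text \<open>Together with the preceding relations, read from left to right, these bring all words
  compared below to normal form.\<close>

lemma s_reduce:
  "s 1 (s 2 (s 0 (s 2 x))) = s 0 (s 1 (s 2 (s 0 x)))"
  "s 1 (s 2 (s 0 (s 1 x))) = s 2 (s 1 (s 2 (s 0 x)))"
  "s 3 (s 2 (s 0 (s 2 x))) = s 0 (s 3 (s 2 (s 0 x)))"
  "s 3 (s 2 (s 0 (s 3 x))) = s 2 (s 3 (s 2 (s 0 x)))"
  "s 3 (s 2 (s 1 (s 2 x))) = s 1 (s 3 (s 2 (s 1 x)))"
  "s 3 (s 2 (s 1 (s 3 x))) = s 2 (s 3 (s 2 (s 1 x)))"
  "s 4 (s 2 (s 0 (s 2 x))) = s 0 (s 4 (s 2 (s 0 x)))"
  "s 4 (s 2 (s 0 (s 4 x))) = s 2 (s 4 (s 2 (s 0 x)))"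
  "s 4 (s 2 (s 1 (s 2 x))) = s 1 (s 4 (s 2 (s 1 x)))"
  "s 4 (s 2 (s 1 (s 4 x))) = s 2 (s 4 (s 2 (s 1 x)))"
  "s 4 (s 2 (s 3 (s 2 x))) = s 3 (s 4 (s 2 (s 3 x)))"
  "s 4 (s 2 (s 3 (s 4 x))) = s 2 (s 4 (s 2 (s 3 x)))"
  "s 4 (s 2 (s 0 (s 1 (s 2 (s 0 x))))) = s 1 (s 4 (s 2 (s 0 (s 1 (s 2 x)))))"
  by (metis s_commute s_braid)+

text \<open>tau_j is fixed by all s_i with i different from j, so words in front of it matter only
  modulo the subgroup generated by these. For example s_0 s_2 s_0 = s_2 s_0 s_2, and the last s_2 is
  absorbed by tau_0.\<close>

lemma s_tau_reduce:
  "s 0 (s 2 (s 0 (\<tau> 0))) = s 2 (s 0 (\<tau> 0))"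
  "s 1 (s 0 (\<tau> 0)) = s 0 (\<tau> 0)"
  "s 2 (s 1 (s 2 (s 0 (\<tau> 0)))) = s 1 (s 2 (s 0 (\<tau> 0)))"
  "s 0 (s 1 (s 2 (s 0 (\<tau> 0)))) = s 1 (s 2 (s 0 (\<tau> 0)))"
  "s 3 (s 0 (\<tau> 0)) = s 0 (\<tau> 0)"
  "s 2 (s 3 (s 2 (s 0 (\<tau> 0)))) = s 3 (s 2 (s 0 (\<tau> 0)))"
  "s 0 (s 3 (s 2 (s 0 (\<tau> 0)))) = s 3 (s 2 (s 0 (\<tau> 0)))"
  "s 4 (s 0 (\<tau> 0)) = s 0 (\<tau> 0)"
  "s 2 (s 4 (s 2 (s 0 (\<tau> 0)))) = s 4 (s 2 (s 0 (\<tau> 0)))"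
  "s 0 (s 4 (s 2 (s 0 (\<tau> 0)))) = s 4 (s 2 (s 0 (\<tau> 0)))"
  "s 1 (s 2 (s 1 (\<tau> 1))) = s 2 (s 1 (\<tau> 1))"
  "s 0 (s 1 (\<tau> 1)) = s 1 (\<tau> 1)"
  "s 2 (s 0 (s 2 (s 1 (\<tau> 1)))) = s 0 (s 2 (s 1 (\<tau> 1)))"
  "s 1 (s 0 (s 2 (s 1 (\<tau> 1)))) = s 0 (s 2 (s 1 (\<tau> 1)))"
  "s 3 (s 1 (\<tau> 1)) = s 1 (\<tau> 1)"
  "s 2 (s 3 (s 2 (s 1 (\<tau> 1)))) = s 3 (s 2 (s 1 (\<tau> 1)))"
  "s 1 (s 3 (s 2 (s 1 (\<tau> 1)))) = s 3 (s 2 (s 1 (\<tau> 1)))"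
  "s 4 (s 1 (\<tau> 1)) = s 1 (\<tau> 1)"
  "s 2 (s 4 (s 2 (s 1 (\<tau> 1)))) = s 4 (s 2 (s 1 (\<tau> 1)))"
  "s 1 (s 4 (s 2 (s 1 (\<tau> 1)))) = s 4 (s 2 (s 1 (\<tau> 1)))"
  "s 3 (s 2 (s 3 (\<tau> 3))) = s 2 (s 3 (\<tau> 3))"
  "s 0 (s 3 (\<tau> 3)) = s 3 (\<tau> 3)"
  "s 2 (s 0 (s 2 (s 3 (\<tau> 3)))) = s 0 (s 2 (s 3 (\<tau> 3)))"
  "s 3 (s 0 (s 2 (s 3 (\<tau> 3)))) = s 0 (s 2 (s 3 (\<tau> 3)))"
  "s 1 (s 3 (\<tau> 3)) = s 3 (\<tau> 3)"
  "s 2 (s 1 (s 2 (s 3 (\<tau> 3)))) = s 1 (s 2 (s 3 (\<tau> 3)))"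
  "s 3 (s 1 (s 2 (s 3 (\<tau> 3)))) = s 1 (s 2 (s 3 (\<tau> 3)))"
  "s 4 (s 3 (\<tau> 3)) = s 3 (\<tau> 3)"
  "s 2 (s 4 (s 2 (s 3 (\<tau> 3)))) = s 4 (s 2 (s 3 (\<tau> 3)))"
  "s 3 (s 4 (s 2 (s 3 (\<tau> 3)))) = s 4 (s 2 (s 3 (\<tau> 3)))"
  "s 4 (s 2 (s 4 (\<tau> 4))) = s 2 (s 4 (\<tau> 4))"
  "s 0 (s 4 (\<tau> 4)) = s 4 (\<tau> 4)"
  "s 2 (s 0 (s 2 (s 4 (\<tau> 4)))) = s 0 (s 2 (s 4 (\<tau> 4)))"
  "s 4 (s 0 (s 2 (s 4 (\<tau> 4)))) = s 0 (s 2 (s 4 (\<tau> 4)))"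
  "s 1 (s 4 (\<tau> 4)) = s 4 (\<tau> 4)"
  "s 2 (s 1 (s 2 (s 4 (\<tau> 4)))) = s 1 (s 2 (s 4 (\<tau> 4)))"
  "s 4 (s 1 (s 2 (s 4 (\<tau> 4)))) = s 1 (s 2 (s 4 (\<tau> 4)))"
  "s 3 (s 4 (\<tau> 4)) = s 4 (\<tau> 4)"
  "s 2 (s 3 (s 2 (s 4 (\<tau> 4)))) = s 3 (s 2 (s 4 (\<tau> 4)))"
  "s 4 (s 3 (s 2 (s 4 (\<tau> 4)))) = s 3 (s 2 (s 4 (\<tau> 4)))"
  by (metis s_commute s_braid s_tau_fixed)+

text \<open>\<open>flip i\<close> changes the sign of \<open>\<tau> i\<close> and fixes the other generators. It is written as a word
  so that it is an automorphism by construction.\<close>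

definition flip :: "nat \<Rightarrow> 'a \<Rightarrow> 'a" where
  "flip i = (if i = 2 then act [5, 2, 5, 2] else act [i, 5, 2, 5, 2, i, 5, 2, 5, 2])"

section \<open>Sign changes of the tau variables\<close>

lemma automorphism_flip: "i \<le> 4 \<Longrightarrow> field_automorphism (flip i)"
  by (auto simp: flip_def intro!: automorphism_act)

lemmas flip_hom = automorphism_simps[OF automorphism_flip]

lemma flip_const:
  assumes "i \<le> 4"
  shows "flip i (\<iota> c) = \<iota> c" "flip i r = r" "flip i u = u" "flip i J = J" "flip i Z = Z" "flip i t = t"
proof -
  show *: "flip i (\<iota> c) = \<iota> c" "flip i r = r" "flip i u = u" for c
    using assms by (simp_all add: flip_def act_const)
  show "flip i J = J" "flip i Z = Z" by (simp_all add: J_def Z_def *)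
  show "flip i t = t" using flip_hom(9)[OF assms, of r 4] * quartic_roots by simp
qed

text \<open>s_2 tau_2 contains the factor \<open>p\<close>, whose image under s_5 carries a minus
  sign, while the constants from the four outer tau variables cancel. Hence the commutator
  \<open>[5, 2, 5, 2]\<close> moves nothing but the sign of tau_2.\<close>

lemma s5_s2_values:
  "s 5 (s 2 q) = s 2 (s 5 q)" "s 5 (s 2 p) = s 2 (s 5 p)"
  "s 5 (s 2 (\<tau> 2)) = - s 2 (s 5 (\<tau> 2))"
  by (simp_all add: act_eval nz divide_simps) (simp_all add: algebra_simps root_identities)

lemma flip_2_values:
  "flip 2 q = q" "flip 2 p = p" "flip 2 (\<alpha> 0) = \<alpha> 0" "flip 2 (\<alpha> 1) = \<alpha> 1"
  "flip 2 (\<alpha> 2) = \<alpha> 2"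
  "flip 2 (\<alpha> 3) = \<alpha> 3" "flip 2 (\<alpha> 4) = \<alpha> 4" "flip 2 (\<tau> 0) = \<tau> 0"
  "flip 2 (\<tau> 1) = \<tau> 1"
  "flip 2 (\<tau> 2) = - \<tau> 2" "flip 2 (\<tau> 3) = \<tau> 3" "flip 2 (\<tau> 4) = \<tau> 4"
proof -
  show "flip 2 q = q" "flip 2 p = p" "flip 2 (\<tau> 2) = - \<tau> 2"
    by (simp_all add: flip_def act_simps s5_s2_values s_involution s_hom)
qed (simp_all add: flip_def act_simps s_hom s_const s_alpha_values s_tau_fixed s_tau_diagram s5 nz,
    simp_all add: field_simps nz)

text \<open>s_0 tau_0 contains tau_2 exactly once, so the conjugate of \<open>flip 2\<close> by s_0
  changes the signs of tau_0 and tau_2; a further \<open>flip 2\<close> restores tau_2. The cases 1,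
  3, 4 are analogous.\<close>

lemma flip_0_values:
  "flip 0 q = q" "flip 0 p = p" "flip 0 (\<alpha> 0) = \<alpha> 0" "flip 0 (\<alpha> 1) = \<alpha> 1"
  "flip 0 (\<alpha> 2) = \<alpha> 2" "flip 0 (\<alpha> 3) = \<alpha> 3" "flip 0 (\<alpha> 4) = \<alpha> 4"
  "flip 0 (\<tau> 0) = - \<tau> 0" "flip 0 (\<tau> 1) = \<tau> 1" "flip 0 (\<tau> 2) = \<tau> 2"
  "flip 0 (\<tau> 3) = \<tau> 3" "flip 0 (\<tau> 4) = \<tau> 4"
proof -
  have *: "flip 0 x = s 0 (flip 2 (s 0 (flip 2 x)))" for x
    by (simp add: flip_def act_simps)
  show "flip 0 q = q" "flip 0 p = p" "flip 0 (\<alpha> 0) = \<alpha> 0" "flip 0 (\<alpha> 1) = \<alpha> 1"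
    "flip 0 (\<alpha> 2) = \<alpha> 2" "flip 0 (\<alpha> 3) = \<alpha> 3" "flip 0 (\<alpha> 4) = \<alpha> 4"
    "flip 0 (\<tau> 0) = - \<tau> 0" "flip 0 (\<tau> 1) = \<tau> 1" "flip 0 (\<tau> 2) = \<tau> 2"
    "flip 0 (\<tau> 3) = \<tau> 3" "flip 0 (\<tau> 4) = \<tau> 4"
    by (simp_all add: * s_hom s_const s_values flip_2_values flip_hom flip_const nz)
qed

lemma flip_1_values:
  "flip 1 q = q" "flip 1 p = p" "flip 1 (\<alpha> 0) = \<alpha> 0" "flip 1 (\<alpha> 1) = \<alpha> 1"
  "flip 1 (\<alpha> 2) = \<alpha> 2" "flip 1 (\<alpha> 3) = \<alpha> 3" "flip 1 (\<alpha> 4) = \<alpha> 4"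
  "flip 1 (\<tau> 0) = \<tau> 0" "flip 1 (\<tau> 1) = - \<tau> 1" "flip 1 (\<tau> 2) = \<tau> 2"
  "flip 1 (\<tau> 3) = \<tau> 3" "flip 1 (\<tau> 4) = \<tau> 4"
proof -
  have *: "flip 1 x = s 1 (flip 2 (s 1 (flip 2 x)))" for x
    by (simp add: flip_def act_simps)
  show "flip 1 q = q" "flip 1 p = p" "flip 1 (\<alpha> 0) = \<alpha> 0" "flip 1 (\<alpha> 1) = \<alpha> 1"
    "flip 1 (\<alpha> 2) = \<alpha> 2" "flip 1 (\<alpha> 3) = \<alpha> 3" "flip 1 (\<alpha> 4) = \<alpha> 4"
    "flip 1 (\<tau> 0) = \<tau> 0" "flip 1 (\<tau> 1) = - \<tau> 1" "flip 1 (\<tau> 2) = \<tau> 2"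
    "flip 1 (\<tau> 3) = \<tau> 3" "flip 1 (\<tau> 4) = \<tau> 4"
    by (simp_all add: * s_hom s_const s_values flip_2_values flip_hom flip_const nz)
qed

lemma flip_3_values:
  "flip 3 q = q" "flip 3 p = p" "flip 3 (\<alpha> 0) = \<alpha> 0" "flip 3 (\<alpha> 1) = \<alpha> 1"
  "flip 3 (\<alpha> 2) = \<alpha> 2" "flip 3 (\<alpha> 3) = \<alpha> 3" "flip 3 (\<alpha> 4) = \<alpha> 4"
  "flip 3 (\<tau> 0) = \<tau> 0" "flip 3 (\<tau> 1) = \<tau> 1" "flip 3 (\<tau> 2) = \<tau> 2"
  "flip 3 (\<tau> 3) = - \<tau> 3" "flip 3 (\<tau> 4) = \<tau> 4"
proof -
  have *: "flip 3 x = s 3 (flip 2 (s 3 (flip 2 x)))" for x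
    by (simp add: flip_def act_simps)
  show "flip 3 q = q" "flip 3 p = p" "flip 3 (\<alpha> 0) = \<alpha> 0" "flip 3 (\<alpha> 1) = \<alpha> 1"
    "flip 3 (\<alpha> 2) = \<alpha> 2" "flip 3 (\<alpha> 3) = \<alpha> 3" "flip 3 (\<alpha> 4) = \<alpha> 4"
    "flip 3 (\<tau> 0) = \<tau> 0" "flip 3 (\<tau> 1) = \<tau> 1" "flip 3 (\<tau> 2) = \<tau> 2"
    "flip 3 (\<tau> 3) = - \<tau> 3" "flip 3 (\<tau> 4) = \<tau> 4"
    by (simp_all add: * s_hom s_const s_values flip_2_values flip_hom flip_const nz)
qed

lemma flip_4_values:
  "flip 4 q = q" "flip 4 p = p" "flip 4 (\<alpha> 0) = \<alpha> 0" "flip 4 (\<alpha> 1) = \<alpha> 1"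
  "flip 4 (\<alpha> 2) = \<alpha> 2" "flip 4 (\<alpha> 3) = \<alpha> 3" "flip 4 (\<alpha> 4) = \<alpha> 4"
  "flip 4 (\<tau> 0) = \<tau> 0" "flip 4 (\<tau> 1) = \<tau> 1" "flip 4 (\<tau> 2) = \<tau> 2"
  "flip 4 (\<tau> 3) = \<tau> 3" "flip 4 (\<tau> 4) = - \<tau> 4"
proof -
  have *: "flip 4 x = s 4 (flip 2 (s 4 (flip 2 x)))" for x
    by (simp add: flip_def act_simps)
  show "flip 4 q = q" "flip 4 p = p" "flip 4 (\<alpha> 0) = \<alpha> 0" "flip 4 (\<alpha> 1) = \<alpha> 1"
    "flip 4 (\<alpha> 2) = \<alpha> 2" "flip 4 (\<alpha> 3) = \<alpha> 3" "flip 4 (\<alpha> 4) = \<alpha> 4"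
    "flip 4 (\<tau> 0) = \<tau> 0" "flip 4 (\<tau> 1) = \<tau> 1" "flip 4 (\<tau> 2) = \<tau> 2"
    "flip 4 (\<tau> 3) = \<tau> 3" "flip 4 (\<tau> 4) = - \<tau> 4"
    by (simp_all add: * s_hom s_const s_values flip_2_values flip_hom flip_const nz)
qed

lemmas flip_values = flip_0_values flip_1_values flip_2_values flip_3_values flip_4_values

text \<open>Conjugation by s_k permutes products of sign changes. Which product \<open>h\<close>
  arises is read off from the parity of the exponent of tau_i in each s_k tau_j: one flip for
  diagram letters, two when an s_k links node i with the centre.\<close>

lemma flip_commuteI:
  assumes ik: "i \<le> 4" "k \<le> 7" and h: "h = flip j \<or> h = flip j \<circ> flip j'" and jj: "j \<le> 4"
  "j' \<le> 4"
    and "flip i (s k q) = s k (h q)" "flip i (s k p) = s k (h p)"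
    and "flip i (s k (\<alpha> 0)) = s k (h (\<alpha> 0))" "flip i (s k (\<alpha> 1)) = s k (h (\<alpha> 1))"
      "flip i (s k (\<alpha> 2)) = s k (h (\<alpha> 2))" "flip i (s k (\<alpha> 3)) = s k (h (\<alpha> 3))"
      "flip i (s k (\<alpha> 4)) = s k (h (\<alpha> 4))"
    and "flip i (s k (\<tau> 0)) = s k (h (\<tau> 0))" "flip i (s k (\<tau> 1)) = s k (h (\<tau> 1))"
      "flip i (s k (\<tau> 2)) = s k (h (\<tau> 2))" "flip i (s k (\<tau> 3)) = s k (h (\<tau> 3))"
      "flip i (s k (\<tau> 4)) = s k (h (\<tau> 4))"
  shows "flip i (s k x) = s k (h x)"
proof -
  have h': "field_automorphism h" "h (\<iota> c) = \<iota> c" "h r = r" "h u = u" for c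
    using h jj by (auto intro!: automorphism_comp automorphism_flip simp: flip_const)
  have "(flip i \<circ> s k) x = (s k \<circ> h) x"
    by (rule word_eqI, intro automorphism_comp automorphism_flip s_automorphism ik,
        intro automorphism_comp s_automorphism ik h')
       (use assms(6-) ik in \<open>auto simp: h' flip_const s_const\<close>)
  then show ?thesis by simp
qed

lemmas flip_eval = flip_hom flip_const flip_values s_hom s_const s_values

lemma s_2_diagramI:
  assumes k: "k \<le> 7"
    and "s k (s 2 q) = s 2 (s k q)" "s k (s 2 p) = s 2 (s k p)"
    and "s k (s 2 (\<alpha> 0)) = s 2 (s k (\<alpha> 0))" "s k (s 2 (\<alpha> 1)) = s 2 (s k (\<alpha> 1))"
      "s k (s 2 (\<alpha> 2)) = s 2 (s k (\<alpha> 2))" "s k (s 2 (\<alpha> 3)) = s 2 (s k (\<alpha> 3))"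
      "s k (s 2 (\<alpha> 4)) = s 2 (s k (\<alpha> 4))"
    and "s k (s 2 (\<tau> 0)) = s 2 (s k (\<tau> 0))" "s k (s 2 (\<tau> 1)) = s 2 (s k (\<tau> 1))"
      "s k (s 2 (\<tau> 2)) = - s 2 (s k (\<tau> 2))" "s k (s 2 (\<tau> 3)) = s 2 (s k (\<tau> 3))"
      "s k (s 2 (\<tau> 4)) = s 2 (s k (\<tau> 4))"
  shows "s k (s 2 x) = s 2 (s k (flip 2 x))"
proof -
  have "field_automorphism (s k \<circ> s 2)" "field_automorphism (s 2 \<circ> s k \<circ> flip 2)"
    using k by (auto intro!: automorphism_comp automorphism_flip s_automorphism)
  then have "(s k \<circ> s 2) x = (s 2 \<circ> s k \<circ> flip 2) x"
    by (rule word_eqI)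
      (use assms(2-) k in \<open>auto simp: flip_2_values flip_const s_const s_hom(5)\<close>)
  then show ?thesis by simp
qed

text \<open>For s_5 this rearranges the definition of \<open>flip 2\<close>; s_6 and s_7 need the
  same correction, so one family of sign changes serves all three.\<close>

lemma s_2_diagram:
  "s 5 (s 2 x) = s 2 (s 5 (flip 2 x))"
  "s 6 (s 2 x) = s 2 (s 6 (flip 2 x))"
  "s 7 (s 2 x) = s 2 (s 7 (flip 2 x))"
  by (rule s_2_diagramI; (simp add: act_eval nz; fail)?; (simp add: act_eval nz)?;
      (simp add: divide_simps nz)?; (simp add: algebra_simps root_identities; fail)?)+

lemma flip_0_commute:
  "flip 0 (s 0 x) = s 0 (flip 0 x)"
  "flip 0 (s 1 x) = s 1 (flip 0 x)"
  "flip 0 (s 2 x) = s 2 (flip 0 (flip 2 x))"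
  "flip 0 (s 3 x) = s 3 (flip 0 x)"
  "flip 0 (s 4 x) = s 4 (flip 0 x)"
  "flip 0 (s 5 x) = s 5 (flip 1 x)"
  "flip 0 (s 6 x) = s 6 (flip 3 x)"
  "flip 0 (s 7 x) = s 7 (flip 4 x)"
proof -
  show "flip 0 (s 0 x) = s 0 (flip 0 x)"
    using flip_commuteI[of 0 0 "flip 0" 0 0 x] by (simp add: flip_eval nz)
  show "flip 0 (s 1 x) = s 1 (flip 0 x)"
    using flip_commuteI[of 0 1 "flip 0" 0 0 x] by (simp add: flip_eval nz)
  show "flip 0 (s 2 x) = s 2 (flip 0 (flip 2 x))"
    using flip_commuteI[of 0 2 "flip 0 \<circ> flip 2" 0 2 x] by (simp add: flip_eval nz)
  show "flip 0 (s 3 x) = s 3 (flip 0 x)"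
    using flip_commuteI[of 0 3 "flip 0" 0 0 x] by (simp add: flip_eval nz)
  show "flip 0 (s 4 x) = s 4 (flip 0 x)"
    using flip_commuteI[of 0 4 "flip 0" 0 0 x] by (simp add: flip_eval nz)
  show "flip 0 (s 5 x) = s 5 (flip 1 x)"
    using flip_commuteI[of 0 5 "flip 1" 1 1 x] by (simp add: flip_eval nz)
  show "flip 0 (s 6 x) = s 6 (flip 3 x)"
    using flip_commuteI[of 0 6 "flip 3" 3 3 x] by (simp add: flip_eval nz)
  show "flip 0 (s 7 x) = s 7 (flip 4 x)"
    using flip_commuteI[of 0 7 "flip 4" 4 4 x] by (simp add: flip_eval nz)
qed

lemma flip_1_commute:
  "flip 1 (s 0 x) = s 0 (flip 1 x)"
  "flip 1 (s 1 x) = s 1 (flip 1 x)"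
  "flip 1 (s 2 x) = s 2 (flip 1 (flip 2 x))"
  "flip 1 (s 3 x) = s 3 (flip 1 x)"
  "flip 1 (s 4 x) = s 4 (flip 1 x)"
  "flip 1 (s 5 x) = s 5 (flip 0 x)"
  "flip 1 (s 6 x) = s 6 (flip 4 x)"
  "flip 1 (s 7 x) = s 7 (flip 3 x)"
proof -
  show "flip 1 (s 0 x) = s 0 (flip 1 x)"
    using flip_commuteI[of 1 0 "flip 1" 1 1 x] by (simp add: flip_eval nz)
  show "flip 1 (s 1 x) = s 1 (flip 1 x)"
    using flip_commuteI[of 1 1 "flip 1" 1 1 x] by (simp add: flip_eval nz)
  show "flip 1 (s 2 x) = s 2 (flip 1 (flip 2 x))"
    using flip_commuteI[of 1 2 "flip 1 \<circ> flip 2" 1 2 x] by (simp add: flip_eval nz)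
  show "flip 1 (s 3 x) = s 3 (flip 1 x)"
    using flip_commuteI[of 1 3 "flip 1" 1 1 x] by (simp add: flip_eval nz)
  show "flip 1 (s 4 x) = s 4 (flip 1 x)"
    using flip_commuteI[of 1 4 "flip 1" 1 1 x] by (simp add: flip_eval nz)
  show "flip 1 (s 5 x) = s 5 (flip 0 x)"
    using flip_commuteI[of 1 5 "flip 0" 0 0 x] by (simp add: flip_eval nz)
  show "flip 1 (s 6 x) = s 6 (flip 4 x)"
    using flip_commuteI[of 1 6 "flip 4" 4 4 x] by (simp add: flip_eval nz)
  show "flip 1 (s 7 x) = s 7 (flip 3 x)"
    using flip_commuteI[of 1 7 "flip 3" 3 3 x] by (simp add: flip_eval nz)
qed

lemma flip_2_commute:
  "flip 2 (s 0 x) = s 0 (flip 2 (flip 0 x))"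
  "flip 2 (s 1 x) = s 1 (flip 2 (flip 1 x))"
  "flip 2 (s 2 x) = s 2 (flip 2 x)"
  "flip 2 (s 3 x) = s 3 (flip 2 (flip 3 x))"
  "flip 2 (s 4 x) = s 4 (flip 2 (flip 4 x))"
  "flip 2 (s 5 x) = s 5 (flip 2 x)"
  "flip 2 (s 6 x) = s 6 (flip 2 x)"
  "flip 2 (s 7 x) = s 7 (flip 2 x)"
proof -
  show "flip 2 (s 0 x) = s 0 (flip 2 (flip 0 x))"
    using flip_commuteI[of 2 0 "flip 2 \<circ> flip 0" 2 0 x] by (simp add: flip_eval nz)
  show "flip 2 (s 1 x) = s 1 (flip 2 (flip 1 x))"
    using flip_commuteI[of 2 1 "flip 2 \<circ> flip 1" 2 1 x] by (simp add: flip_eval nz)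
  show "flip 2 (s 2 x) = s 2 (flip 2 x)"
    using flip_commuteI[of 2 2 "flip 2" 2 2 x] by (simp add: flip_eval nz)
  show "flip 2 (s 3 x) = s 3 (flip 2 (flip 3 x))"
    using flip_commuteI[of 2 3 "flip 2 \<circ> flip 3" 2 3 x] by (simp add: flip_eval nz)
  show "flip 2 (s 4 x) = s 4 (flip 2 (flip 4 x))"
    using flip_commuteI[of 2 4 "flip 2 \<circ> flip 4" 2 4 x] by (simp add: flip_eval nz)
  show "flip 2 (s 5 x) = s 5 (flip 2 x)"
    using flip_commuteI[of 2 5 "flip 2" 2 2 x] by (simp add: flip_eval nz)
  show "flip 2 (s 6 x) = s 6 (flip 2 x)"
    using flip_commuteI[of 2 6 "flip 2" 2 2 x] by (simp add: flip_eval nz)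
  show "flip 2 (s 7 x) = s 7 (flip 2 x)"
    using flip_commuteI[of 2 7 "flip 2" 2 2 x] by (simp add: flip_eval nz)
qed

lemma flip_3_commute:
  "flip 3 (s 0 x) = s 0 (flip 3 x)"
  "flip 3 (s 1 x) = s 1 (flip 3 x)"
  "flip 3 (s 2 x) = s 2 (flip 3 (flip 2 x))"
  "flip 3 (s 3 x) = s 3 (flip 3 x)"
  "flip 3 (s 4 x) = s 4 (flip 3 x)"
  "flip 3 (s 5 x) = s 5 (flip 4 x)"
  "flip 3 (s 6 x) = s 6 (flip 0 x)"
  "flip 3 (s 7 x) = s 7 (flip 1 x)"
proof -
  show "flip 3 (s 0 x) = s 0 (flip 3 x)"
    using flip_commuteI[of 3 0 "flip 3" 3 3 x] by (simp add: flip_eval nz)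
  show "flip 3 (s 1 x) = s 1 (flip 3 x)"
    using flip_commuteI[of 3 1 "flip 3" 3 3 x] by (simp add: flip_eval nz)
  show "flip 3 (s 2 x) = s 2 (flip 3 (flip 2 x))"
    using flip_commuteI[of 3 2 "flip 3 \<circ> flip 2" 3 2 x] by (simp add: flip_eval nz)
  show "flip 3 (s 3 x) = s 3 (flip 3 x)"
    using flip_commuteI[of 3 3 "flip 3" 3 3 x] by (simp add: flip_eval nz)
  show "flip 3 (s 4 x) = s 4 (flip 3 x)"
    using flip_commuteI[of 3 4 "flip 3" 3 3 x] by (simp add: flip_eval nz)
  show "flip 3 (s 5 x) = s 5 (flip 4 x)"
    using flip_commuteI[of 3 5 "flip 4" 4 4 x] by (simp add: flip_eval nz)
  show "flip 3 (s 6 x) = s 6 (flip 0 x)"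
    using flip_commuteI[of 3 6 "flip 0" 0 0 x] by (simp add: flip_eval nz)
  show "flip 3 (s 7 x) = s 7 (flip 1 x)"
    using flip_commuteI[of 3 7 "flip 1" 1 1 x] by (simp add: flip_eval nz)
qed

lemma flip_4_commute:
  "flip 4 (s 0 x) = s 0 (flip 4 x)"
  "flip 4 (s 1 x) = s 1 (flip 4 x)"
  "flip 4 (s 2 x) = s 2 (flip 4 (flip 2 x))"
  "flip 4 (s 3 x) = s 3 (flip 4 x)"
  "flip 4 (s 4 x) = s 4 (flip 4 x)"
  "flip 4 (s 5 x) = s 5 (flip 3 x)"
  "flip 4 (s 6 x) = s 6 (flip 1 x)"
  "flip 4 (s 7 x) = s 7 (flip 0 x)"
proof -
  show "flip 4 (s 0 x) = s 0 (flip 4 x)"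
    using flip_commuteI[of 4 0 "flip 4" 4 4 x] by (simp add: flip_eval nz)
  show "flip 4 (s 1 x) = s 1 (flip 4 x)"
    using flip_commuteI[of 4 1 "flip 4" 4 4 x] by (simp add: flip_eval nz)
  show "flip 4 (s 2 x) = s 2 (flip 4 (flip 2 x))"
    using flip_commuteI[of 4 2 "flip 4 \<circ> flip 2" 4 2 x] by (simp add: flip_eval nz)
  show "flip 4 (s 3 x) = s 3 (flip 4 x)"
    using flip_commuteI[of 4 3 "flip 4" 4 4 x] by (simp add: flip_eval nz)
  show "flip 4 (s 4 x) = s 4 (flip 4 x)"
    using flip_commuteI[of 4 4 "flip 4" 4 4 x] by (simp add: flip_eval nz)
  show "flip 4 (s 5 x) = s 5 (flip 3 x)"
    using flip_commuteI[of 4 5 "flip 3" 3 3 x] by (simp add: flip_eval nz)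
  show "flip 4 (s 6 x) = s 6 (flip 1 x)"
    using flip_commuteI[of 4 6 "flip 1" 1 1 x] by (simp add: flip_eval nz)
  show "flip 4 (s 7 x) = s 7 (flip 0 x)"
    using flip_commuteI[of 4 7 "flip 0" 0 0 x] by (simp add: flip_eval nz)
qed

lemmas flip_commute = flip_0_commute flip_1_commute flip_2_commute flip_3_commute flip_4_commute

lemma act_append: "act (vs @ ws) x = act vs (act ws x)"
  by (simp add: act_def)

lemma act_rev: "set ws \<subseteq> {..7} \<Longrightarrow> act (rev ws) (act ws x) = x"
proof (induction ws arbitrary: x)
  case (Cons k ws)
  then have "k \<in> {0, 1, 2, 3, 4, 5, 6, 7}" by auto
  then have "s k (s k y) = y" for y using s_involution[of y] by auto
  then show ?case using Cons by (simp add: act_append act_simps)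
qed (simp add: act_simps)

lemma act_rev': "set ws \<subseteq> {..7} \<Longrightarrow> act ws (act (rev ws) x) = x"
  using act_rev[of "rev ws"] by simp

section \<open>Central scalings\<close>

text \<open>With weight 1 for the outer tau variables and weight 2 for tau_2, every s_k preserves
  weights; hence such a scaling commutes with all s_k. That \<open>l\<close> is a scalar makes every
  s_k fix it, and \<open>l ^ 4 = 1\<close> makes it nonzero.\<close>

definition central :: "('a \<Rightarrow> 'a) \<Rightarrow> 'a \<Rightarrow> bool" where
  "central C l \<longleftrightarrow> field_automorphism C \<and> (\<forall>c. C (\<iota> c) = \<iota> c) \<and> C r = r \<and> C u = u \<and> C q = q \<and> C p = p \<and>
     (\<forall>j \<in> {0, 1, 2, 3, 4}. C (\<alpha> j) = \<alpha> j) \<and> (\<forall>j \<in> {0, 1, 3, 4}. C (\<tau> j) = l * \<tau> j) \<and> C (\<tau> 2) = l ^ 2 * \<tau> 2 \<and>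
     l \<in> range \<iota> \<and> l ^ 4 = 1"

lemma central_commute:
  assumes C: "central C l" and k: "k \<le> 7"
  shows "C (s k x) = s k (C x)"
proof -
  note c = C[unfolded central_def]
  have hom: "field_automorphism C" using c by blast
  have l: "s k l = l" using c k by (auto simp: s_const)
  have l0: "l \<noteq> 0" and l4: "l * (l * (l * l)) = 1" using c by (auto simp: power4_eq_xxxx mult.assoc)
  then have l4': "l * (l * (l * (l * y))) = y" for y by (metis mult.assoc mult_1)
  have gens: "C (\<iota> c) = \<iota> c" "C r = r" "C u = u" "C q = q" "C p = p" "C t = t" "C J = J" "C Z = Z"
    "C (\<alpha> 0) = \<alpha> 0" "C (\<alpha> 1) = \<alpha> 1" "C (\<alpha> 2) = \<alpha> 2"
    "C (\<alpha> 3) = \<alpha> 3" "C (\<alpha> 4) = \<alpha> 4"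
    "C (\<tau> 0) = l * \<tau> 0" "C (\<tau> 1) = l * \<tau> 1" "C (\<tau> 2) = l * l * \<tau> 2"
    "C (\<tau> 3) = l * \<tau> 3" "C (\<tau> 4) = l * \<tau> 4" for c
    using c automorphism_power[OF hom, of r 4] quartic_roots by (auto simp: J_def Z_def power2_eq_square)
  have "C (s k y) = s k (C y)" if y: "y \<in> {q, p, \<alpha> 0, \<alpha> 1, \<alpha> 2, \<alpha> 3, \<alpha> 4, \<tau> 0, \<tau> 1, \<tau> 2, \<tau> 3, \<tau> 4}" for y
  proof -
    have "k \<in> {0, 1, 2, 3, 4, 5, 6, 7}" using k by auto
    then show ?thesis
      using y l
      by (elim insertE emptyE; simp only:;
          simp add: automorphism_simps[OF hom] gens s_hom s_const s_values l0;
          (simp add: divide_simps nz l0; fail)?; (simp add: field_simps nz l0 l4 l4'; fail)?)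
  qed
  then have eq: "\<forall>y \<in> {q, p, \<alpha> 0, \<alpha> 1, \<alpha> 2, \<alpha> 3, \<alpha> 4, \<tau> 0, \<tau> 1, \<tau> 2, \<tau> 3, \<tau> 4}.
      (C \<circ> s k) y = (s k \<circ> C) y" by simp
  have "(C \<circ> s k) x = (s k \<circ> C) x"
  proof (rule word_eqI[where g = "C \<circ> s k" and h = "s k \<circ> C"])
    show "field_automorphism (C \<circ> s k)" "field_automorphism (s k \<circ> C)"
      by (intro automorphism_comp hom s_automorphism k)+
    show "(C \<circ> s k) (\<iota> c) = (s k \<circ> C) (\<iota> c)" for c
      by (simp add: gens s_const k)
    show "(C \<circ> s k) r = (s k \<circ> C) r"
      "(C \<circ> s k) u = (s k \<circ> C) u"
      by (simp_all add: gens s_const k)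
  qed (use eq in blast)+
  then show ?thesis by simp
qed

text \<open>Invariance is the working condition in place of being a quotient of tau functions: it is
  stable under all words, which permits induction on powers of translations.\<close>

definition central_invariant :: "'a \<Rightarrow> bool" where
  "central_invariant x \<longleftrightarrow> (\<forall>C l. central C l \<longrightarrow> C x = x)"

definition weight_one :: "'a \<Rightarrow> bool" where
  "weight_one x \<longleftrightarrow> (\<forall>C l. central C l \<longrightarrow> C x = l * x)"

lemma central_act: "central C l \<Longrightarrow> set ws \<subseteq> {..7} \<Longrightarrow> C (act ws x) = act ws (C x)"
  by (induction ws) (simp_all add: act_simps central_commute)

lemma central_invariant_act: "central_invariant x \<Longrightarrow> set ws \<subseteq> {..7} \<Longrightarrow> central_invariant (act ws x)"
  unfolding central_invariant_def by (metis central_act)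

lemma weight_one_act:
  assumes x: "weight_one x" and ws: "set ws \<subseteq> {..7}"
  shows "weight_one (act ws x)"
  unfolding weight_one_def
proof (intro allI impI)
  fix C l assume C: "central C l"
  then have "act ws l = l" using act_const[OF ws] by (auto simp: central_def)
  then show "C (act ws x) = l * act ws x"
    using x C ws unfolding weight_one_def
    by (metis central_act automorphism_mult automorphism_act)
qed

lemma weight_one_tau: "j \<in> {0, 1, 3, 4} \<Longrightarrow> weight_one (\<tau> j)"
  unfolding weight_one_def central_def by blast

lemma central_invariant_quotient: "weight_one x \<Longrightarrow> weight_one y \<Longrightarrow> central_invariant (x / y)"
  unfolding central_invariant_def
proof (intro allI impI)
  fix C l assume xy: "weight_one x" "weight_one y" and C: "central C l"
  then have "C x = l * x" "C y = l * y" "l \<noteq> 0" "field_automorphism C"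
    by (auto simp: weight_one_def central_def)
  then show "C (x / y) = x / y" by (simp add: automorphism_divide)
qed

text \<open>Since reversal inverts, the word is the commutator vs^-1 ws^-1 vs ws. Comparing the two
  products on generators involves words of half its length, and the inverses fix the scalar that
  remains.\<close>

lemma commutator_central:
  assumes sub: "set vs \<subseteq> {..7}" "set ws \<subseteq> {..7}"
    and l: "l \<in> range \<iota>" "l ^ 4 = 1"
    and eq: "\<And>y. y \<in> {q, p, \<alpha> 0, \<alpha> 1, \<alpha> 2, \<alpha> 3, \<alpha> 4} \<Longrightarrow> act vs (act ws y) = act ws (act vs y)"
    and eq_tau: "\<And>j. j \<in> {0, 1, 3, 4} \<Longrightarrow> act vs (act ws (\<tau> j)) = l * act ws (act vs (\<tau> j))"
      "act vs (act ws (\<tau> 2)) = l ^ 2 * act ws (act vs (\<tau> 2))"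
  shows "central (act (rev vs @ rev ws @ vs @ ws)) l"
proof -
  let ?C = "act (rev vs @ rev ws @ vs @ ws)"
  have sub': "set (rev vs @ rev ws @ vs @ ws) \<subseteq> {..7}" "set (rev vs) \<subseteq> {..7}"
    "set (rev ws) \<subseteq> {..7}"
    using sub by auto
  have scale: "?C y = k * y" if "act vs (act ws y) = k * act ws (act vs y)" "k \<in> range \<iota>" for k y
    using that sub sub' act_const[OF sub'(2)] act_const[OF sub'(3)]
    by (auto simp: act_append act_rev automorphism_mult[OF automorphism_act])
  have "1 \<in> range \<iota>" "l ^ 2 \<in> range \<iota>"
    using l embedding_1 embedding_mult by (auto simp: power2_eq_square image_iff) metis+
  then show ?thesis
    using l act_const[OF sub'(1)] scale[of _ 1] eq scale[of _ l] eq_tau scale[of _ "l ^ 2"]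
    by (auto simp: central_def automorphism_act[OF sub'(1)])
qed

lemma central_invariant_commute:
  assumes C: "central (act (rev vs @ rev ws @ vs @ ws)) l"
    and sub: "set vs \<subseteq> {..7}" "set ws \<subseteq> {..7}" and x: "central_invariant x"
  shows "act vs (act ws x) = act ws (act vs x)"
proof -
  have "act (rev vs @ rev ws @ vs @ ws) x = x" using C x by (auto simp: central_invariant_def)
  then have "act ws (act vs (act (rev vs) (act (rev ws) (act vs (act ws x))))) = act ws (act vs x)"
    by (simp add: act_append)
  then show ?thesis using sub by (simp add: act_rev')
qed

lemma weight_one_commute:
  assumes C: "central (act (rev vs @ rev ws @ vs @ ws)) l"
    and sub: "set vs \<subseteq> {..7}" "set ws \<subseteq> {..7}" and x: "weight_one x"
  shows "act vs (act ws x) = l * act ws (act vs x)"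
proof -
  have "act (rev vs @ rev ws @ vs @ ws) x = l * x" using C x by (auto simp: weight_one_def)
  then have "act ws (act vs (act (rev vs) (act (rev ws) (act vs (act ws x))))) = act ws (act vs (l * x))"
    by (simp add: act_append)
  moreover have "act ws (act vs l) = l" using C act_const[OF sub(1)] act_const[OF sub(2)] by (auto simp: central_def)
  ultimately show ?thesis using sub by (simp add: act_rev' automorphism_mult[OF automorphism_act])
qed

section \<open>Commutators of the translations\<close>

lemma diagram_swap:
  "s 7 (s 5 q) = s 5 (s 7 q)" "s 7 (s 5 p) = s 5 (s 7 p)" "s 7 (s 5 (\<tau> 2)) = - s 5 (s 7 (\<tau> 2))"
  "s 7 (s 6 q) = s 6 (s 7 q)" "s 7 (s 6 p) = s 6 (s 7 p)" "s 7 (s 6 (\<tau> 2)) = - s 6 (s 7 (\<tau> 2))"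
  by (simp_all add: act_eval nz) (simp_all add: divide_simps nz, simp_all add: algebra_simps root_identities)

abbreviation "w13 \<equiv> [1, 2, 0, 4, 2, 1, 7]"
abbreviation "w40 \<equiv> [4, 2, 1, 3, 2, 4, 7]"
abbreviation "w34 \<equiv> [3, 2, 0, 1, 2, 3, 5]"
abbreviation "w14 \<equiv> [1, 4, 2, 0, 3, 2, 6]"

text \<open>The formulas by which s_0, ..., s_4 move generators are left out on purpose: words are
  brought to normal form with no rational function expanded. The diagram letters travel to the
  right; on \<open>q\<close>, \<open>p\<close> and tau_2, where they too stay unevaluated,
  \<open>diagram_swap\<close> aligns their order.\<close>

lemmas word_simps = act_simps s_involution s_commute s_braid s_reduce s_diagram s_2_diagram
  flip_commute flip_values flip_const flip_hom s_hom s_const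
  s5(1-5) s6(1-5) s7(1-5) s_tau_diagram diagram_swap

lemma J_power4: "J ^ 4 = 1"
  by (simp add: power4_eq_xxxx J_square)

lemma J_range: "J \<in> range \<iota>" "- J \<in> range \<iota>" "- 1 \<in> range \<iota>"
  using embedding_neg_1 embedding_mult[of "- 1"
  "\<i>"] by (auto simp: J_def image_iff intro: exI[of _ "- 1"]) (metis mult_minus1)+

text \<open>Both translations contain s_7 once, and these letters cancel. The factor -1 on the four
  outer tau variables comes from the sign changes left behind by moving s_7 through the other
  letters.\<close>

lemma T13_T40_central:
  "central (act (rev w13 @ rev (rev w40) @ w13 @ rev w40)) (- 1)"
  by (rule commutator_central; (simp add: J_range J_power4; fail)?;
      (elim insertE emptyE)?; (simp add: word_simps; fail)?;
      (simp add: word_simps power2_eq_square J_square)?;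
      (simp add: field_simps nz JZ_square J_square Z_square)?)

text \<open>Here fourth roots of unity appear: s_7 s_5 and s_5 s_7 differ on each outer tau by
  \<open>J\<close> or \<open>- J\<close>, because \<open>Z * Z = - J\<close>. In the pairs with T14
  the factors \<open>J\<close> in the action of s_6 have the same effect.\<close>

lemma T13_T34_central:
  "central (act (rev w13 @ rev w34 @ w13 @ w34)) (- J)"
  by (rule commutator_central; (simp add: J_range J_power4; fail)?;
      (elim insertE emptyE)?; (simp add: word_simps; fail)?;
      (simp add: word_simps power2_eq_square J_square)?;
      (simp add: field_simps nz JZ_square J_square Z_square)?)

lemma T40_T34_central:
  "central (act (rev w40 @ rev w34 @ w40 @ w34)) J"
  by (rule commutator_central; (simp add: J_range J_power4; fail)?;
      (elim insertE emptyE)?; (simp add: word_simps; fail)?;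
      (simp add: word_simps power2_eq_square J_square)?;
      (simp add: field_simps nz JZ_square J_square Z_square)?)

lemma T13_T14_central:
  "central (act (rev w13 @ rev (rev w14) @ w13 @ rev w14)) (- J)"
  by (rule commutator_central; (simp add: J_range J_power4; fail)?;
      (elim insertE emptyE)?; (simp add: word_simps; fail)?;
      (simp add: word_simps power2_eq_square J_square)?;
      (simp add: field_simps nz JZ_square J_square Z_square)?)

lemma T40_T14_central:
  "central (act (rev (rev w40) @ rev w14 @ rev w40 @ w14)) J"
  by (rule commutator_central; (simp add: J_range J_power4; fail)?;
      (elim insertE emptyE)?; (simp add: word_simps; fail)?;
      (simp add: word_simps power2_eq_square J_square)?;
      (simp add: field_simps nz JZ_square J_square Z_square)?)

text \<open>The word is the translation along the root \<open>\<alpha> 2\<close>: its halves \<open>[0, 1, 3, 4, 2, 0, 1, 3, 4]\<close> and \<open>[2]\<close>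
  are the reflections in \<open>\<alpha> 0 + \<alpha> 1 + \<alpha> 2 + \<alpha> 3 + \<alpha> 4\<close> and \<open>\<alpha> 2\<close>.\<close>

definition ratio :: "nat \<Rightarrow> 'a" where
  "ratio j = act [0, 1, 3, 4, 2, 0, 1, 3, 4, 2] (\<tau> j) / \<tau> j"

text \<open>T40^-1 T13 is, up to signs and scalars, the translation of \<open>ratio\<close>
  conjugated by s_3 s_4. Both letters fix tau_0, so they can be pulled in front of the
  quotient.\<close>

lemma base_ratio_act:
  "act (rev w40) (act w13 (\<tau> 0)) / \<tau> 0 = - act [3, 4] (ratio 0)"
  by (simp add: ratio_def word_simps s_tau_fixed s_tau_reduce nz)
    (simp add: field_simps nz)

text \<open>The three translations together shift alpha by (1, -1, 0, 0, 0) and carry tau_0 to a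
  constant times tau_1; in the next two lemmas the points reached are s_3 tau_3 and s_4 tau_4. These
  are the images of tau_1, tau_3, tau_4 under s_3 s_4.\<close>

lemma even_face_1:
  "act (rev w34) (act (rev w40) (act (rev w13) (act [3, 4] (ratio 0)))) = - act [3, 4] (ratio 1)"
  by (simp add: ratio_def word_simps s_tau_fixed s_tau_reduce nz)

lemma even_face_3:
  "act w14 (act (rev w40) (act (rev w13) (act [3, 4] (ratio 0)))) = - act [3, 4] (ratio 3)"
  by (simp add: ratio_def word_simps s_tau_fixed s_tau_reduce nz)

lemma even_face_4:
  "act w14 (act [3, 4] (ratio 1)) = - act [3, 4] (ratio 4)"
  by (simp add: ratio_def word_simps s_tau_fixed s_tau_reduce nz)

text \<open>\<open>[1, 4, 2, 1, 3]\<close> sends \<open>\<alpha> 2\<close> to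
  \<open>\<alpha> 2 + \<alpha> 3 + \<alpha> 4\<close>, as \<open>[3, 4]\<close> does, so both
  conjugate h to the same translation. They also agree on tau_0 and tau_4, which gives the edge that
  an odd square shares with the even square to its right; they differ on tau_1 and tau_3.\<close>

lemma odd_face_1:
  "act (rev w34) (act [3, 4] (ratio 0)) = - act [1, 4, 2, 1, 3] (ratio 1)"
  by (simp add: ratio_def word_simps s_tau_fixed s_tau_reduce nz)

lemma odd_face_0:
  "act [3, 4] (ratio 0) = act [1, 4, 2, 1, 3] (ratio 0)"
  by (simp add: ratio_def word_simps s_tau_fixed s_tau_reduce nz)

lemma odd_face_3:
  "act w14 (act [3, 4] (ratio 0)) = - act [1, 4, 2, 1, 3] (ratio 3)"
  by (simp add: ratio_def word_simps s_tau_fixed s_tau_reduce nz)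

lemma odd_face_4:
  "act [3, 4] (ratio 4) = act [1, 4, 2, 1, 3] (ratio 4)"
  by (simp add: ratio_def word_simps s_tau_fixed s_tau_reduce nz)

end

section \<open>Powers of the translations\<close>

lemma int_iterate_0: "int_iterate g 0 x = x"
  by (simp add: int_iterate_def)

lemma int_iterate_step:
  assumes "bij g"
  shows "int_iterate g (k + 1) x = g (int_iterate g k x)" "int_iterate g (k + 1) x = int_iterate g k (g x)"
proof -
  have *: "g (inv g y) = y" "inv g (g y) = y" for y
    using assms by (simp_all add: bij_is_surj surj_f_inv_f bij_is_inj)
  have "int_iterate g (k + 1) x = g (int_iterate g k x) \<and> int_iterate g (k + 1) x = int_iterate g k (g x)"
  proof (cases "0 \<le> k")
    case True
    then have "nat (k + 1) = Suc (nat k)" by simp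
    then show ?thesis using True by (simp add: int_iterate_def funpow_swap1)
  next
    case False
    then have k: "nat (- k) = Suc (nat (- (k + 1)))" by simp
    have "(inv g ^^ nat (- k)) (g x) = (inv g ^^ nat (- (k + 1))) x"
      "g ((inv g ^^ nat (- k)) x) = (inv g ^^ nat (- (k + 1))) x"
      unfolding k by (simp_all only: funpow_Suc_right) (simp_all add: * flip: funpow_swap1 funpow.simps)
    moreover have "int_iterate g (k + 1) x = (inv g ^^ nat (- (k + 1))) x"
      using False by (cases "k = - 1") (simp_all add: int_iterate_def)
    ultimately show ?thesis using False by (simp add: int_iterate_def)
  qed
  then show "int_iterate g (k + 1) x = g (int_iterate g k x)" "int_iterate g (k + 1) x = int_iterate g k (g x)"
    by auto
qed

lemma int_iterate_pred:
  assumes "bij g"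
  shows "int_iterate g (k - 1) x = int_iterate g k (inv g x)"
  using int_iterate_step(2)[OF assms, of "k - 1" "inv g x"] assms
  by (simp add: bij_is_surj surj_f_inv_f)

lemma int_iterate_cases:
  obtains n where "int_iterate g k = g ^^ n" "n = nat \<bar>k\<bar>" | n where "int_iterate g k = inv g ^^ n"
  "n = nat \<bar>k\<bar>"
  by (cases "0 \<le> k") (auto simp: int_iterate_def)

lemma automorphism_funpow: "field_automorphism g \<Longrightarrow> field_automorphism (g ^^ n)"
proof (induction n)
  case 0
  then show ?case by (simp add: field_automorphism_def bij_def)
qed (simp add: automorphism_comp)

lemma automorphism_int_iterate: "field_automorphism g \<Longrightarrow> field_automorphism (int_iterate g k)"
  by (rule int_iterate_cases[of g k]) (simp_all add: automorphism_funpow automorphism_inv)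

definition int_sign :: "int \<Rightarrow> 'a::ring_1" where
  "int_sign k = (if even k then 1 else - 1)"

lemma automorphism_int_sign: "field_automorphism g \<Longrightarrow> g (int_sign k) = int_sign k"
  using automorphism_1[of g] automorphism_uminus[of g 1] by (simp add: int_sign_def)

lemma int_sign_nat: "0 \<le> k \<Longrightarrow> (- 1) ^ nat k = (int_sign k :: 'a::ring_1)"
  by (simp add: int_sign_def minus_one_power_iff even_nat_iff)

text \<open>The binomials are k (2k - 1) and k (2k + 1), and the second factor is odd.\<close>

lemma int_sign_binom2:
  "(- 1) ^ int_binom2 (2 * k) = (int_sign k :: 'a::ring_1)"
  "(- 1) ^ int_binom2 (2 * k + 1) = (int_sign k :: 'a::ring_1)"
proof -
  have "2 * k * (2 * k - 1) div 2 = k * (2 * k - 1)" "(2 * k + 1) * (2 * k + 1 - 1) div 2 = k * (2 * k + 1)"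
    by (simp_all add: algebra_simps)
  moreover have "0 \<le> k * (2 * k - 1)" "0 \<le> k * (2 * k + 1)"
    by (auto simp: zero_le_mult_iff)
  ultimately show "(- 1) ^ int_binom2 (2 * k) = (int_sign k :: 'a::ring_1)"
    "(- 1) ^ int_binom2 (2 * k + 1) = (int_sign k :: 'a::ring_1)"
    unfolding int_binom2_def by (simp_all only: int_sign_nat) (simp_all add: int_sign_def)
qed

context pvi_tau_system
begin

lemma inv_act: "set ws \<subseteq> {..7} \<Longrightarrow> inv (act ws) = act (rev ws)"
  by (rule inv_equality) (simp_all add: act_rev act_rev')

lemma translation_words: "T13 s = act w13" "T40 s = act w40" "T34 s = act w34" "T14 s = act w14"
  by (simp_all add: fun_eq_iff T13_def T40_def T34_def T14_def act_simps)

text \<open>Restricted to invariant elements, because on the tau functions themselves a scalar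
  factor remains.\<close>

definition commuting :: "nat list \<Rightarrow> nat list \<Rightarrow> bool" where
  "commuting vs ws \<longleftrightarrow> (\<forall>x. central_invariant x \<longrightarrow> act vs (act ws x) = act ws (act vs x))"

lemma commuting_sym: "commuting vs ws \<Longrightarrow> commuting ws vs"
  by (simp add: commuting_def)

lemma commuting_rev:
  assumes "commuting vs ws" "set ws \<subseteq> {..7}"
  shows "commuting vs (rev ws)"
  unfolding commuting_def
proof (intro allI impI)
  fix x assume "central_invariant x"
  then have "central_invariant (act (rev ws) x)" using assms by (simp add: central_invariant_act)
  then have "act vs (act ws (act (rev ws) x)) = act ws (act vs (act (rev ws) x))"
    using assms(1) by (simp add: commuting_def)
  then show "act vs (act (rev ws) x) = act (rev ws) (act vs x)"
    using assms(2) by (metis act_rev act_rev')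
qed

lemma commuting_funpow:
  assumes "commuting vs ws" "set ws \<subseteq> {..7}" "central_invariant x"
  shows "act vs ((act ws ^^ n) x) = (act ws ^^ n) (act vs x)"
  using assms(3)
proof (induction n arbitrary: x)
  case (Suc n)
  then have "act vs ((act ws ^^ n) (act ws x)) = (act ws ^^ n) (act vs (act ws x))"
    using assms(2) by (simp add: central_invariant_act)
  then show ?case using assms(1) Suc.prems by (simp add: funpow_swap1 commuting_def)
qed simp

lemma commuting_int_iterate:
  assumes "commuting vs ws" "set ws \<subseteq> {..7}" "central_invariant x"
  shows "act vs (int_iterate (act ws) k x) = int_iterate (act ws) k (act vs x)"
  using commuting_funpow[OF assms] commuting_funpow[OF commuting_rev[OF assms(1,2)], of x] assms(2,3)
  by (simp add: int_iterate_def inv_act)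

lemma central_invariant_int_iterate: "central_invariant x \<Longrightarrow> set ws \<subseteq> {..7} \<Longrightarrow> central_invariant (int_iterate (act ws) k x)"
proof -
  assume *: "central_invariant x" "set ws \<subseteq> {..7}"
  have "central_invariant ((act vs ^^ n) x)" if "set vs \<subseteq> {..7}" for vs n
    using *(1) that by (induction n) (simp_all add: central_invariant_act)
  then show ?thesis using * by (simp add: int_iterate_def inv_act)
qed

lemma weight_one_funpow: "weight_one x \<Longrightarrow> set ws \<subseteq> {..7} \<Longrightarrow> weight_one ((act ws ^^ n) x)"
  by (induction n) (simp_all add: weight_one_act)

lemma translations_commuting:
  "commuting w34 w13" "commuting w34 w40" "commuting w14 w13" "commuting w14 w40" "commuting (rev w40) w13"
proof -
  have c: "commuting [1, 2, 0, 4, 2, 1, 7] (rev w40)" "commuting w13 w34" "commuting w40 w34"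
    "commuting w13 (rev w14)" "commuting (rev w40) w14"
    unfolding commuting_def
    using central_invariant_commute[OF T13_T40_central] central_invariant_commute[OF T13_T34_central] central_invariant_commute[OF T40_T34_central]
      central_invariant_commute[OF T13_T14_central] central_invariant_commute[OF T40_T14_central] by simp_all
  show "commuting w34 w13" "commuting w34 w40" "commuting (rev w40) w13"
    using c(1-3) commuting_sym by blast+
  show "commuting w14 w13" using commuting_sym[OF commuting_rev[OF c(4)]] by simp
  show "commuting w14 w40" using commuting_rev[OF commuting_sym[OF c(5)]] by simp
qed

text \<open>Each passage of T40^-1 through T13 or its inverse costs one factor -1 on elements of
  weight one.\<close>

lemma T40_T13_sign:
  assumes "weight_one x"
  shows "act (rev w40) (int_iterate (act w13) k x) = int_sign k * int_iterate (act w13) k (act (rev w40) x)"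
proof -
  have neg: "act ws (- y) = - act ws y" if "set ws \<subseteq> {..7}" for ws y
    by (rule automorphism_uminus[OF automorphism_act[OF that]])
  have 1: "act (rev w40) (act w13 y) = - act w13 (act (rev w40) y)" if "weight_one y" for y
    using weight_one_commute[OF T13_T40_central _ _ that] by simp
  have 2: "act (rev w40) (act (rev w13) y) = - act (rev w13) (act (rev w40) y)" if y: "weight_one y" for y
  proof -
    have "weight_one (act (rev w13) y)" by (rule weight_one_act[OF y]) simp
    from 1[OF this] have "act (rev w40) y = - act w13 (act (rev w40) (act (rev w13) y))"
      using act_rev'[of w13 y] by simp
    then have "act (rev w13) (act (rev w40) y) = - act (rev w40) (act (rev w13) y)"
      using act_rev[of w13] neg[of "rev w13"] by simp
    then show ?thesis by simp
  qed
  have "act (rev w40) ((act ws ^^ n) x) = (- 1) ^ n * (act ws ^^ n) (act (rev w40) x)"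
    if ws: "ws = w13 \<or> ws = rev w13" for ws n
  proof (induction n)
    case (Suc n)
    have sub: "set ws \<subseteq> {..7}" using ws by auto
    have "act (rev w40) (act ws ((act ws ^^ n) x)) = - act ws (act (rev w40) ((act ws ^^ n) x))"
      using 1 2 ws weight_one_funpow[OF assms sub, of n] by blast
    also have "\<dots> = (- 1) ^ Suc n * (act ws ^^ Suc n) (act (rev w40) x)"
      unfolding Suc using automorphism_act[OF sub]
      by (simp add: automorphism_mult automorphism_power automorphism_uminus automorphism_1)
    finally show ?case by simp
  qed simp
  from this[of w13 "nat k"] this[of "rev w13" "nat (- k)"] show ?thesis
    using int_sign_nat[of k, where 'a = 'a] int_sign_nat[of "- k", where 'a = 'a] inv_act[of w13]
    by (cases "0 \<le> k") (simp_all add: int_iterate_def int_sign_def)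
qed


text \<open>T40^-k T13^-k is the part common to numerator and denominator of z; raising k by one
  raises n + m by two.\<close>

definition shift :: "int \<Rightarrow> 'a \<Rightarrow> 'a" where
  "shift k x = int_iterate (act w40) (- k) (int_iterate (act w13) (- k) x)"

text \<open>The extra T40^-1 has to pass T13^-k, which costs no sign because \<open>x\<close> is
  invariant.\<close>

lemma shift_add_1:
  assumes "central_invariant x"
  shows "shift (k + 1) x = shift k (act (rev w40) (act (rev w13) x))"
proof -
  have b: "bij (act w13)" "bij (act w40)" by (simp_all add: automorphism_bij[OF automorphism_act])
  have "central_invariant (act (rev w13) x)" by (rule central_invariant_act[OF assms]) simp
  then show ?thesis
    using int_iterate_pred[OF b(1), of "- k"] int_iterate_pred[OF b(2), of "- k"]
      commuting_int_iterate[OF translations_commuting(5)]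
    by (simp add: shift_def inv_act minus_add_distrib flip: diff_conv_add_uminus)
qed

lemma shift_commute:
  assumes "commuting vs w13" "commuting vs w40" "central_invariant x"
  shows "act vs (shift k x) = shift k (act vs x)"
  using commuting_int_iterate[OF assms(1)] commuting_int_iterate[OF assms(2)] assms(3)
  by (simp add: shift_def central_invariant_int_iterate)

lemma automorphism_shift: "field_automorphism (shift k)"
  using automorphism_comp[OF automorphism_int_iterate[OF automorphism_act] automorphism_int_iterate[OF automorphism_act], of w40 w13 "- k" "- k"]
  by (simp add: shift_def[abs_def] comp_def)

section \<open>The values of z as translates of a single ratio\<close>

definition base_ratio :: 'a where
  "base_ratio = act (rev w40) (act w13 (\<tau> 0)) / \<tau> 0"

lemma central_invariant_base_ratio: "central_invariant base_ratio"
  unfolding base_ratio_def by (intro central_invariant_quotient weight_one_act weight_one_tau) simp_all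

text \<open>The numerator has one more T40^-1 and one more T13 than the denominator. Bringing T40^-1
  next to T13 tau_0 past T13^-k produces the sign, and the rest is a translate of tau_(1,-1,0,0) /
  tau_(0,0,0,0).\<close>

lemma tau_fn_quotient:
  "int_iterate (act w40) (- k - 1) (int_iterate (act w13) (- k + 1) (\<tau> 0)) /
     int_iterate (act w40) (- k) (int_iterate (act w13) (- k) (\<tau> 0)) = int_sign k * shift k base_ratio"
proof -
  have b: "bij (act w13)" "bij (act w40)" by (simp_all add: automorphism_bij[OF automorphism_act])
  have hom: "field_automorphism (int_iterate (act vs) j)" if "set vs \<subseteq> {..7}" for vs j
    using that by (intro automorphism_int_iterate automorphism_act)
  have "weight_one (act w13 (\<tau> 0))"
    by (intro weight_one_act weight_one_tau) simp_all
  from T40_T13_sign[OF this, of "- k"]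
  have "act (rev w40) (int_iterate (act w13) (- k + 1) (\<tau> 0)) =
      int_sign k * int_iterate (act w13) (- k) (act (rev w40) (act w13 (\<tau> 0)))"
    using int_iterate_step(2)[OF b(1), of "- k"] by (simp add: int_sign_def)
  then show ?thesis
    using int_iterate_pred[OF b(2), of "- k"] hom[of w40 "- k"] hom[of w13 "- k"]
    by (simp add: shift_def base_ratio_def inv_act automorphism_mult automorphism_divide automorphism_int_sign)
qed

text \<open>The binomial sign is (-1)^(k - m + 1), so the (-1)^k of the tau quotient
  cancels.\<close>

lemma dskdv_z_even:
  assumes "n + m = 2 * k"
  shows "dskdv_z s \<tau> n m = - (int_sign m * int_iterate (act w14) m (shift k base_ratio))"
proof -
  have hom: "field_automorphism (int_iterate (act w14) m)"
    by (intro automorphism_int_iterate automorphism_act) simp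
  have nm: "n - m + 2 = 2 * (k - m + 1)" and ev: "even (n + m)" "(n + m) div 2 = k" using assms by auto
  have "dskdv_z s \<tau> n m = int_sign (k - m + 1) * int_iterate (act w14) m (int_sign k * shift k base_ratio)"
    unfolding dskdv_z_def tau_fn_def translation_words nm int_sign_binom2
    using ev(1) by (simp only: ev(2) if_True int_iterate_0 automorphism_divide[OF hom, symmetric] tau_fn_quotient)
  then show ?thesis
    by (simp add: automorphism_mult[OF hom] automorphism_int_sign[OF hom]) (simp add: int_sign_def)
qed

text \<open>Writing n + m as 2k - 1 gives the first two indices the same values in terms of k as in
  the even case; only the inner factor T34^-1 is new.\<close>

lemma dskdv_z_odd:
  assumes "n + m = 2 * k - 1"
  shows "dskdv_z s \<tau> n m = int_sign m * int_iterate (act w14) m (act (rev w34) (shift k base_ratio))"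
proof -
  have hom: "field_automorphism (int_iterate (act w14) m)" "field_automorphism (act (rev w34))"
    by (intro automorphism_int_iterate automorphism_act; simp)+
  have b: "bij (act w34)" by (simp add: automorphism_bij[OF automorphism_act])
  have i34: "int_iterate (act w34) (- 1) x = act (rev w34) x" for x
    using int_iterate_pred[OF b, of 0] by (simp add: int_iterate_0 inv_act)
  have nm: "n - m + 2 = 2 * (k - m) + 1" and ev: "odd (n + m)" "(n + m - 1) div 2 = k - 1" "(n + m + 1) div 2 = k"
    using assms by auto
  have k: "- (k - 1) = - k + 1" by simp
  have "dskdv_z s \<tau> n m = int_sign (k - m) * int_iterate (act w14) m (act (rev w34) (int_sign k * shift k base_ratio))"
    unfolding dskdv_z_def tau_fn_def translation_words nm int_sign_binom2 i34
    using ev(1) by (simp only: ev(2,3) k if_False automorphism_divide[OF hom(1), symmetric] 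
      automorphism_divide[OF hom(2), symmetric] tau_fn_quotient)
  then show ?thesis
    by (simp only: automorphism_mult[OF hom(1)] automorphism_mult[OF hom(2)] automorphism_int_sign[OF hom(1)] automorphism_int_sign[OF hom(2)])
      (simp add: int_sign_def)
qed

section \<open>The two elementary squares\<close>

lemma ratio_values:
  obtains K F where "K \<noteq> 0" "ratio 0 = K * (F + (1 - \<alpha> 2) / (q - t))" "ratio 1 = K * F"
    "ratio 3 = K * (F + (1 - \<alpha> 2) / (q - 1))" "ratio 4 = K * (F + (1 - \<alpha> 2) / q)"
proof -
  \<comment> \<open>\<open>F\<close> is the image of \<open>p\<close> under s_0 s_1 s_3 s_4, and
    \<open>K\<close> is what remains of \<open>ratio 1\<close> after \<open>F\<close> is divided
    out.\<close>
  define K where "K = (q - t) * (q - 1) * q * \<tau> 2 * \<tau> 2 / (r * r * \<tau> 0 * \<tau> 1 * \<tau> 3 * \<tau> 4)"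
  define F where "F = p - \<alpha> 0 / (q - t) - \<alpha> 3 / (q - 1) - \<alpha> 4 / q"
  let ?c = "act [0, 1, 3, 4]"
  have vals: "?c p = F" "?c q = q" "?c r = r" "?c t = t" "?c (\<alpha> 2) = 1 - \<alpha> 2"
    "?c (\<tau> 0) = (q - t) * \<tau> 2 / \<tau> 0"
    "?c (\<tau> 1) = \<tau> 2 / \<tau> 1" "?c (\<tau> 2) = \<tau> 2"
    "?c (\<tau> 3) = (q - 1) * \<tau> 2 / \<tau> 3" "?c (\<tau> 4) = q * \<tau> 2 / \<tau> 4"
    using alpha_sum by (simp_all add: act_eval F_def algebra_simps)
  have y0: "ratio 0 = K * (F + (1 - \<alpha> 2) / (q - t))"
  proof -
    \<comment> \<open>The inner six letters yield an expression linear in \<open>p\<close>; the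
      outer four then act by the substitutions in \<open>vals\<close>, where
      \<open>\<alpha> 2\<close> becomes \<open>1 - \<alpha> 2\<close>.\<close>
    have "act [2, 0, 1, 3, 4, 2] (\<tau> 0) = (p * (q - t) + \<alpha> 2) * (\<tau> 1 * \<tau> 3 * \<tau> 4) / (r * r * \<tau> 2)"
      by (simp add: act_eval nz divide_simps) (simp add: algebra_simps)?
    then have "act [0, 1, 3, 4, 2, 0, 1, 3, 4, 2] (\<tau> 0) = act [0, 1, 3, 4] ((p * (q - t) + \<alpha> 2) * (\<tau> 1 * \<tau> 3 * \<tau> 4) / (r * r * \<tau> 2))"
      using act_append[of "[0, 1, 3, 4]" "[2, 0, 1, 3, 4, 2]" "\<tau> 0"] by simp
    also have "\<dots> = (F * (q - t) + (1 - \<alpha> 2)) * ((\<tau> 2 / \<tau> 1) * ((q - 1) * \<tau> 2 / \<tau> 3) * (q * \<tau> 2 / \<tau> 4)) / (r * r * \<tau> 2)"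
      by (simp add: automorphism_simps[OF automorphism_act] vals)
    finally show ?thesis using nonzero roots_nonzero
      by (simp add: ratio_def K_def divide_simps) (simp add: mult_ac)?
  qed
  have y1: "ratio 1 = K * (F)"
  proof -
    have "act [2, 0, 1, 3, 4, 2] (\<tau> 1) = p * (\<tau> 0 * \<tau> 3 * \<tau> 4) / (r * r * \<tau> 2)"
      by (simp add: act_eval nz divide_simps) (simp add: algebra_simps)?
    then have "act [0, 1, 3, 4, 2, 0, 1, 3, 4, 2] (\<tau> 1) = act [0, 1, 3, 4] (p * (\<tau> 0 * \<tau> 3 * \<tau> 4) / (r * r * \<tau> 2))"
      using act_append[of "[0, 1, 3, 4]" "[2, 0, 1, 3, 4, 2]" "\<tau> 1"] by simp
    also have "\<dots> = F * (((q - t) * \<tau> 2 / \<tau> 0) * ((q - 1) * \<tau> 2 / \<tau> 3) * (q * \<tau> 2 / \<tau> 4)) / (r * r * \<tau> 2)"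
      by (simp add: automorphism_simps[OF automorphism_act] vals)
    finally show ?thesis using nonzero roots_nonzero
      by (simp add: ratio_def K_def divide_simps) (simp add: mult_ac)?
  qed
  have y3: "ratio 3 = K * (F + (1 - \<alpha> 2) / (q - 1))"
  proof -
    have "act [2, 0, 1, 3, 4, 2] (\<tau> 3) = (p * (q - 1) + \<alpha> 2) * (\<tau> 0 * \<tau> 1 * \<tau> 4) / (r * r * \<tau> 2)"
      by (simp add: act_eval nz divide_simps) (simp add: algebra_simps)?
    then have "act [0, 1, 3, 4, 2, 0, 1, 3, 4, 2] (\<tau> 3) = act [0, 1, 3, 4] ((p * (q - 1) + \<alpha> 2) * (\<tau> 0 * \<tau> 1 * \<tau> 4) / (r * r * \<tau> 2))"
      using act_append[of "[0, 1, 3, 4]" "[2, 0, 1, 3, 4, 2]" "\<tau> 3"] by simp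
    also have "\<dots> = (F * (q - 1) + (1 - \<alpha> 2)) * (((q - t) * \<tau> 2 / \<tau> 0) * (\<tau> 2 / \<tau> 1) * (q * \<tau> 2 / \<tau> 4)) / (r * r * \<tau> 2)"
      by (simp add: automorphism_simps[OF automorphism_act] vals)
    finally show ?thesis using nonzero roots_nonzero
      by (simp add: ratio_def K_def divide_simps) (simp add: mult_ac)?
  qed
  have y4: "ratio 4 = K * (F + (1 - \<alpha> 2) / q)"
  proof -
    have "act [2, 0, 1, 3, 4, 2] (\<tau> 4) = (p * q + \<alpha> 2) * (\<tau> 0 * \<tau> 1 * \<tau> 3) / (r * r * \<tau> 2)"
      by (simp add: act_eval nz divide_simps) (simp add: algebra_simps)?
    then have "act [0, 1, 3, 4, 2, 0, 1, 3, 4, 2] (\<tau> 4) = act [0, 1, 3, 4] ((p * q + \<alpha> 2) * (\<tau> 0 * \<tau> 1 * \<tau> 3) / (r * r * \<tau> 2))"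
      using act_append[of "[0, 1, 3, 4]" "[2, 0, 1, 3, 4, 2]" "\<tau> 4"] by simp
    also have "\<dots> = (F * q + (1 - \<alpha> 2)) * (((q - t) * \<tau> 2 / \<tau> 0) * (\<tau> 2 / \<tau> 1) * ((q - 1) * \<tau> 2 / \<tau> 3)) / (r * r * \<tau> 2)"
      by (simp add: automorphism_simps[OF automorphism_act] vals)
    finally show ?thesis using nonzero roots_nonzero
      by (simp add: ratio_def K_def divide_simps) (simp add: mult_ac)?
  qed
  show ?thesis
    by (rule that[OF _ y0 y1 y3 y4]) (simp add: K_def nz)
qed

text \<open>Signs and order follow the equation, with arguments z(n,m), z(n+1,m), z(n,m+1),
  z(n+1,m+1).\<close>

definition cross_ratio :: "'a \<Rightarrow> 'a \<Rightarrow> 'a \<Rightarrow> 'a \<Rightarrow> 'a" where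
  "cross_ratio a b c d = ((a - b) * (d - c)) / ((b - d) * (c - a))"

lemma cross_ratio_hom: "field_automorphism g \<Longrightarrow> g (cross_ratio a b c d) = cross_ratio (g a) (g b) (g c) (g d)"
  by (simp add: cross_ratio_def automorphism_simps)

lemma cross_ratio_sign: "cross_ratio (int_sign k * a) (int_sign k * b) (int_sign k * c) (int_sign k * d) = cross_ratio a b c d"
  by (auto simp: cross_ratio_def int_sign_def algebra_simps)

text \<open>The first arrangement belongs to even squares, the second to odd ones; exchanging both
  horizontal pairs leaves the cross ratio unchanged. In all differences \<open>F\<close>
  cancels.\<close>

lemma cross_ratio_ratio: "cross_ratio (ratio 0) (ratio 1) (ratio 4) (ratio 3) = 1 / t" "cross_ratio (ratio 1) (ratio 0) (ratio 3) (ratio 4) = 1 / t"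
proof -
  obtain K F where K: "K \<noteq> 0" and y: "ratio 0 = K * (F + (1 - \<alpha> 2) / (q - t))" "ratio 1 = K * F"
    "ratio 3 = K * (F + (1 - \<alpha> 2) / (q - 1))" "ratio 4 = K * (F + (1 - \<alpha> 2) / q)"
    by (rule ratio_values)
  define c where "c = K * (1 - \<alpha> 2)"
  have c: "c \<noteq> 0" using K nonzero_sum by (simp add: c_def)
  have diff: "ratio 0 - ratio 1 = c / (q - t)" "ratio 1 - ratio 0 = - c / (q - t)"
    "ratio 3 - ratio 1 = c / (q - 1)" "ratio 1 - ratio 3 = - c / (q - 1)"
    "ratio 3 - ratio 4 = c / (q * (q - 1))" "ratio 4 - ratio 3 = - c / (q * (q - 1))"
    "ratio 4 - ratio 0 = - c * t / (q * (q - t))" "ratio 0 - ratio 4 = c * t / (q * (q - t))"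
    unfolding y c_def using nonzero by (simp_all add: divide_simps) (simp_all add: algebra_simps)
  show "cross_ratio (ratio 0) (ratio 1) (ratio 4) (ratio 3) = 1 / t"
    "cross_ratio (ratio 1) (ratio 0) (ratio 3) (ratio 4) = 1 / t"
    unfolding cross_ratio_def diff using c nonzero by (simp_all add: divide_simps)
qed

lemma dskdv:
  "cross_ratio (dskdv_z s \<tau> n m) (dskdv_z s \<tau> (n + 1) m) (dskdv_z s \<tau> n (m + 1)) (dskdv_z s \<tau> (n + 1) (m + 1)) = 1 / t"
proof -
  \<comment> \<open>The automorphism common to the four vertices. It fixes \<open>t\<close>, so the
    cross ratio can be computed before it is applied.\<close>
  define G where "G k x = int_iterate (act w14) m (shift k x)" for k x
  have hom14: "field_automorphism (int_iterate (act w14) m)"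
    by (intro automorphism_int_iterate automorphism_act) simp
  have hom: "field_automorphism (G k)" for k
    using automorphism_comp[OF hom14 automorphism_shift] by (simp add: G_def[abs_def] comp_def)
  have t: "g t = t" if "field_automorphism g" "g r = r" for g
    using automorphism_power[OF that(1), of r 4] that(2) quartic_roots by simp
  have iter_r: "int_iterate (act ws) k r = r" if "set ws \<subseteq> {..7}" for ws k
  proof -
    have "(act vs ^^ n) r = r" if "set vs \<subseteq> {..7}" for vs n
      using act_const[OF that] by (induction n) simp_all
    then show ?thesis using that by (simp add: int_iterate_def inv_act)
  qed
  have "G k r = r" for k by (simp add: G_def shift_def iter_r)
  then have Gt: "G k t = t" for k using t[OF hom] by blast
  have step14: "int_iterate (act w14) (m + 1) x = int_iterate (act w14) m (act w14 x)" for x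
    by (rule int_iterate_step(2)[OF automorphism_bij[OF automorphism_act]]) simp
  have sign: "int_sign (m + 1) = - (int_sign m :: 'a)" by (simp add: int_sign_def)
  have com: "commuting (rev w34) w13" "commuting (rev w34) w40"
    using commuting_sym[OF commuting_rev[OF commuting_sym[OF translations_commuting(1)]]]
      commuting_sym[OF commuting_rev[OF commuting_sym[OF translations_commuting(2)]]] by simp_all
  note com14 = translations_commuting(3,4)
  \<comment> \<open>One step of \<open>shift\<close>: this expresses the vertices with parameter k +
    1 through \<open>G k\<close>.\<close>
  let ?w1 = "act (rev w40) (act (rev w13) base_ratio)"
  have inv1: "central_invariant ?w1" by (intro central_invariant_act central_invariant_base_ratio) simp_all
  have neg: "act ws (- x) = - act ws x" if "set ws \<subseteq> {..7}" for ws x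
    by (rule automorphism_uminus[OF automorphism_act[OF that]])
  have inner: "act ws (1 / t) = 1 / t" if "set ws \<subseteq> {..7}" for ws
    using t[OF automorphism_act[OF that]] act_const[OF that] by (simp add: automorphism_simps[OF automorphism_act[OF that]])
  have outer: "cross_ratio (int_sign m * G k a) (int_sign m * G k b) (int_sign m * G k c) (int_sign m * G k d) = 1 / t"
    if "cross_ratio a b c d = 1 / t" for k a b c d
    using cross_ratio_hom[OF hom, of k a b c d] that Gt[of k]
    by (simp add: cross_ratio_sign automorphism_divide[OF hom] automorphism_1[OF hom])
  have base: "base_ratio = - act [3, 4] (ratio 0)" using base_ratio_act by (simp add: base_ratio_def)
  show ?thesis
  proof (cases "even (n + m)")
    case True
    then obtain k where k: "n + m = 2 * k" by blast
    \<comment> \<open>The other three vertices have coordinate sums 2 (k + 1) - 1 or 2 (k + 1),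
      hence \<open>?w1\<close> in all but the first.\<close>
    have z: "dskdv_z s \<tau> n m = int_sign m * G k (- base_ratio)"
      "dskdv_z s \<tau> (n + 1) m = int_sign m * G k (act (rev w34) ?w1)"
      "dskdv_z s \<tau> n (m + 1) = int_sign m * G k (- act w14 (act (rev w34) ?w1))"
      "dskdv_z s \<tau> (n + 1) (m + 1) = int_sign m * G k (act w14 ?w1)"
    proof -
      show "dskdv_z s \<tau> n m = int_sign m * G k (- base_ratio)"
        using dskdv_z_even[OF k] by (simp add: G_def[symmetric] automorphism_uminus[OF hom])
      show "dskdv_z s \<tau> (n + 1) m = int_sign m * G k (act (rev w34) ?w1)"
        using dskdv_z_odd[of "n + 1" m "k + 1"] k
        by (simp only: shift_add_1[OF central_invariant_base_ratio] shift_commute[OF com inv1] G_def) simp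
      show "dskdv_z s \<tau> n (m + 1) = int_sign m * G k (- act w14 (act (rev w34) ?w1))"
        using dskdv_z_odd[of n "m + 1" "k + 1"] k central_invariant_act[OF inv1, of "rev w34"]
        by (simp only: shift_add_1[OF central_invariant_base_ratio] shift_commute[OF com inv1] shift_commute[OF com14] step14 sign automorphism_uminus[OF hom])
          (simp add: G_def shift_commute[OF com14])
      show "dskdv_z s \<tau> (n + 1) (m + 1) = int_sign m * G k (act w14 ?w1)"
        using dskdv_z_even[of "n + 1" "m + 1" "k + 1"] k
        by (simp only: shift_add_1[OF central_invariant_base_ratio] shift_commute[OF com14 inv1] step14 sign G_def) simp
    qed
    have "- base_ratio = act [3, 4] (ratio 0)" "act (rev w34) ?w1 = act [3, 4] (ratio 1)"
      "- act w14 (act (rev w34) ?w1) = act [3, 4] (ratio 4)" "act w14 ?w1 = act [3, 4] (ratio 3)"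
      using even_face_1 even_face_3 even_face_4 by (simp_all add: base neg)
    then show ?thesis
      unfolding z by (intro outer) (simp add: cross_ratio_hom[OF automorphism_act, symmetric] inner cross_ratio_ratio)
  next
    case False
    then obtain k where k: "n + m = 2 * k - 1" by (metis oddE add_diff_cancel_right' diff_add_cancel even_add odd_one)
    \<comment> \<open>Now only the vertex (n + 1, m + 1), with coordinate sum 2 (k + 1) - 1, needs
      the extra step.\<close>
    have z: "dskdv_z s \<tau> n m = int_sign m * G k (act (rev w34) base_ratio)"
      "dskdv_z s \<tau> (n + 1) m = int_sign m * G k (- base_ratio)"
      "dskdv_z s \<tau> n (m + 1) = int_sign m * G k (act w14 base_ratio)"
      "dskdv_z s \<tau> (n + 1) (m + 1) = int_sign m * G k (- act w14 (act (rev w34) ?w1))"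
    proof -
      show "dskdv_z s \<tau> n m = int_sign m * G k (act (rev w34) base_ratio)"
        using dskdv_z_odd[OF k] by (simp only: shift_commute[OF com central_invariant_base_ratio] G_def)
      show "dskdv_z s \<tau> (n + 1) m = int_sign m * G k (- base_ratio)"
        using dskdv_z_even[of "n + 1" m k] k by (simp add: G_def[symmetric] automorphism_uminus[OF hom])
      show "dskdv_z s \<tau> n (m + 1) = int_sign m * G k (act w14 base_ratio)"
        using dskdv_z_even[of n "m + 1" k] k
        by (simp only: shift_commute[OF com14 central_invariant_base_ratio] step14 sign G_def) simp
      show "dskdv_z s \<tau> (n + 1) (m + 1) = int_sign m * G k (- act w14 (act (rev w34) ?w1))"
        using dskdv_z_odd[of "n + 1" "m + 1" "k + 1"] k central_invariant_act[OF inv1, of "rev w34"]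
        by (simp only: shift_add_1[OF central_invariant_base_ratio] shift_commute[OF com inv1] shift_commute[OF com14] step14 sign automorphism_uminus[OF hom])
          (simp add: G_def shift_commute[OF com14])
    qed
    \<comment> \<open>The last vertex is the one at (n, m + 1) in an even square, so the even face
      lemmas identify it before \<open>odd_face_4\<close> changes the word.\<close>
    have "act (rev w34) base_ratio = act [1, 4, 2, 1, 3] (ratio 1)" "- base_ratio = act [1, 4, 2, 1, 3] (ratio 0)"
      "act w14 base_ratio = act [1, 4, 2, 1, 3] (ratio 3)"
      "- act w14 (act (rev w34) ?w1) = act [1, 4, 2, 1, 3] (ratio 4)"
      using even_face_1 even_face_4 odd_face_0 odd_face_1 odd_face_3 odd_face_4 by (simp_all add: base neg)
    then show ?thesis
      unfolding z by (intro outer) (simp add: cross_ratio_hom[OF automorphism_act, symmetric] inner cross_ratio_ratio)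
  qed
qed

end

theorem theorem3p3:
  fixes \<iota> :: "complex \<Rightarrow> 'a::field_char_0"
    and t r u :: 'a and \<alpha> :: "nat \<Rightarrow> 'a" and q p :: 'a and f \<tau> :: "nat \<Rightarrow> 'a"
    and s :: "nat \<Rightarrow> 'a \<Rightarrow> 'a" and z :: "int \<Rightarrow> int \<Rightarrow> 'a" and n m :: int
  assumes "pvi_tau_system \<iota> t r u \<alpha> q p f \<tau> s"
    and "z = dskdv_z s \<tau>"
  shows "((z n m - z (n + 1) m) * (z (n + 1) (m + 1) - z n (m + 1))) /
         ((z (n + 1) m - z (n + 1) (m + 1)) * (z n (m + 1) - z n m)) = 1 / t"
proof -
  interpret pvi_tau_system \<iota> t r u \<alpha> q p f \<tau> s by fact
  show ?thesis using dskdv[of n m] by (simp add: assms(2) cross_ratio_def)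
qed

end
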